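(* Let $p$ be a prime and let $\alpha, \beta \in \mathbb{C}_p$ with $0<|\beta|<1<|\alpha|$. Then for each integer $k \geq 1$, \[ m_{p,k}((t-\alpha)(t-\beta)) = \log_p^k \alpha + \sum_{\substack{i+j\le k\\ i,j\ge 1}} (-1)^{i+j}\frac{k!}{(k-i-j)!}\left(\log_p^{k-i-j}\alpha\right)\operatorname{Li}_{(\{1\}^{i-1}\ast\{1\}^{j-1},\,2)}\!\left(\frac{\beta}{\alpha}\right). \]
   Context: $\mathbb{C}_p$ is the completion of an algebraic closure of $\mathbb{Q}_p$, with absolute value $|\cdot|$ normalized by $|p|=p^{-1}$. Fix the decomposition $\mathbb{C}_p^\times \simeq p^{\mathbb{Q}}\times\mu_{ur}\times U_0$, where $\mu_{ur}$ is the group of roots of unity of order prime to $p$ and $U_0=\{z:|z-1|<1\}$; for $a\in\mathbb{C}_p^\times$ let $\langle a\rangle$ be its component in $U_0$, and define $\log_p a=\sum_{n\ge1}\frac{(-1)^{n-1}}{n}(\langle a\rangle-1)^n$ (so $\log_p p=0$). Write $\log_p^k a=(\log_p a)^k$. For a Laurent polynomial $f\in\mathbb{C}_p[t_1^{\pm1},\dots,t_n^{\pm1}]$ with no zero $(z_1,\dots,z_n)$ with all $|z_i|=1$, the $p$-adic $k$-higher Mahler measure is $m_{p,k}(f)=\lim_{N\to\infty,\,(N,p)=1} N^{-n}\sum_{\zeta\in\mu_N^n}\log_p^k f(\zeta)$, where $\mu_N$ is the set of $N$-th roots of unity in $\mathbb{C}_p$ (this limit exists). For an index $(k_1,\dots,k_r)\in\mathbb{Z}_{>0}^r$,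 $\operatorname{Li}_{(k_1,\dots,k_r)}(t)=\sum_{0<m_1<\dots<m_r} t^{m_r}/(m_1^{k_1}\cdots m_r^{k_r})$, which converges $p$-adically for $|t|<1$. Indices are identified with words in the noncommutative polynomial algebra $\mathbb{Q}\langle e_0,e_1\rangle$ via $(k_1,\dots,k_r)\mapsto e_{k_1}\cdots e_{k_r}$, $e_k:=e_1e_0^{k-1}$; $\mathfrak{H}^1=\mathbb{Q}+e_1\mathbb{Q}\langle e_0,e_1\rangle$. The harmonic product $\ast$ on $\mathfrak{H}^1$ is the $\mathbb{Q}$-bilinear product determined by $w\ast1=1\ast w=w$ and $e_kv\ast e_lw=e_k(v\ast e_lw)+e_l(e_kv\ast w)+e_{k+l}(v\ast w)$ for $k,l\ge1$, $v,w\in\mathfrak{H}^1$. $\{1\}^m$ denotes the index $(1,\dots,1)$ of length $m$ (the word $e_1^m$; $\{1\}^0$ is the empty word $1$). For $w=\sum_u c_u u\in\mathfrak{H}^1$ (a $\mathbb{Q}$-combination of words $u$), $\operatorname{Li}_{(w,2)}:=\sum_u c_u\operatorname{Li}_{(u,2)}$, where $(u,2)$ is the index $u$ with $2$ appended (the word $ue_2$). *)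

theory Defs
  imports
    "HOL-Analysis.Analysis"
    "HOL-Computational_Algebra.Polynomial"
    "HOL-Computational_Algebra.Primes"
    "HOL-Library.Poly_Mapping"
begin

text \<open>
  The absolute value is a class parameter of its own because \<open>norm\<close> is reserved for real normed
  vector spaces, which $p$-adic fields are not. All topological notions (limits, infinite sums,
  closures) are those of the induced metric.
\<close>

class nonarch_complete_field = field_char_0 + complete_space +
  fixes absval :: "'a \<Rightarrow> real"
  assumes dist_absval: "dist x y = absval (x - y)"
    and absval_mult: "absval (x * y) = absval x * absval y"
    and absval_ultrametric: "absval (x + y) \<le> max (absval x) (absval y)"

definition algebraic_over :: "'a::field set \<Rightarrow> 'a \<Rightarrow> bool" where
  "algebraic_over F x \<longleftrightarrow> (\<exists>f. f \<noteq> 0 \<and> (\<forall>i. poly.coeff f i \<in> F) \<and> poly f x = 0)"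

definition alg_closed_subset :: "'a::field set \<Rightarrow> bool" where
  "alg_closed_subset L \<longleftrightarrow>
    (\<forall>f. (\<forall>i. poly.coeff f i \<in> L) \<and> 0 < degree f \<longrightarrow> (\<exists>x\<in>L. poly f x = 0))"

text \<open>
  Since the ambient field is complete, the closure of \<open>\<rat>\<close> in it is the completion of \<open>\<rat>\<close>
  for the restricted absolute value, which is the $p$-adic one as soon as it is
  non-archimedean with $|p| = p^{-1}$. The field is then a completion of an algebraic closure of
  $\mathbf{Q}_p$ iff the elements algebraic over $\mathbf{Q}_p$ form an algebraically closed,
  dense subfield.
\<close>

definition Qp :: "'a::nonarch_complete_field set" where
  "Qp = closure \<rat>"

definition Qp_bar :: "'a::nonarch_complete_field set" where
  "Qp_bar = {x. algebraic_over Qp x}"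

definition is_Cp :: "nat \<Rightarrow> 'a::nonarch_complete_field itself \<Rightarrow> bool" where
  "is_Cp p (_ :: 'a itself) \<longleftrightarrow>
     absval (of_nat p :: 'a) = 1 / real p \<and>
     alg_closed_subset (Qp_bar :: 'a set) \<and>
     closure (Qp_bar :: 'a set) = UNIV"

text \<open>
  The subgroup \<open>p\<^sup>\<rat>\<close> of \<open>\<complex>\<^sub>p\<^sup>\<times>\<close> depends on a choice of a
  compatible system of roots of $p$, i.e. a homomorphism \<open>r \<mapsto> p\<^sup>r\<close> from
  the rationals to the multiplicative group with \<open>p\<^sup>1 = p\<close>.
\<close>

definition is_p_power :: "nat \<Rightarrow> (rat \<Rightarrow> 'a::nonarch_complete_field) \<Rightarrow> bool" where
  "is_p_power p pw \<longleftrightarrow> (\<forall>r s. pw (r + s) = pw r * pw s) \<and> pw 1 = of_nat p"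

definition mu_ur :: "nat \<Rightarrow> 'a::nonarch_complete_field set" where
  "mu_ur p = {z. \<exists>n>0. coprime n p \<and> z ^ n = 1}"

definition U0 :: "'a::nonarch_complete_field set" where
  "U0 = {z. absval (z - 1) < 1}"

definition U0_part :: "nat \<Rightarrow> (rat \<Rightarrow> 'a) \<Rightarrow> 'a \<Rightarrow> 'a::nonarch_complete_field" where
  "U0_part p pw a = (THE u. u \<in> U0 \<and> (\<exists>r. \<exists>\<omega>\<in>mu_ur p. a = pw r * \<omega> * u))"

definition log_p :: "nat \<Rightarrow> (rat \<Rightarrow> 'a) \<Rightarrow> 'a \<Rightarrow> 'a::nonarch_complete_field" where
  "log_p p pw a = suminf (\<lambda>n. (-1) ^ n / of_nat (Suc n) * (U0_part p pw a - 1) ^ Suc n)"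

text \<open>
  Laurent polynomials in variables indexed by a finite type \<open>'n\<close>: finitely supported
  coefficient functions on integer exponent vectors, with the convolution product of
  \<open>Poly_Mapping\<close>.
\<close>

type_synonym ('n, 'a) laurent = "('n \<Rightarrow>\<^sub>0 int) \<Rightarrow>\<^sub>0 'a"

definition laurent_const :: "'a::comm_ring_1 \<Rightarrow> ('n, 'a) laurent" where
  "laurent_const c = Poly_Mapping.single 0 c"

definition laurent_var :: "'n \<Rightarrow> ('n, 'a::comm_ring_1) laurent" where
  "laurent_var i = Poly_Mapping.single (Poly_Mapping.single i 1) 1"

definition laurent_eval :: "('n::finite, 'a::field) laurent \<Rightarrow> ('n \<Rightarrow> 'a) \<Rightarrow> 'a" where
  "laurent_eval f z =
     (\<Sum>e\<in>Poly_Mapping.keys f. Poly_Mapping.lookup f e *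
        (\<Prod>i\<in>UNIV. z i powi Poly_Mapping.lookup e i))"

definition mu :: "nat \<Rightarrow> 'a::field set" where
  "mu N = {z. z ^ N = 1}"

text \<open>
  Only meaningful for \<open>f\<close> without zeros in the locus where all coordinates have absolute value 1.
\<close>

definition mahler_measure_p ::
    "nat \<Rightarrow> (rat \<Rightarrow> 'a::nonarch_complete_field) \<Rightarrow> nat \<Rightarrow> ('n::finite, 'a) laurent \<Rightarrow> 'a" where
  "mahler_measure_p p pw k f =
     Lim (inf sequentially (principal {N. coprime N p}))
       (\<lambda>N. (\<Sum>\<zeta> | \<forall>i. \<zeta> i \<in> mu N. log_p p pw (laurent_eval f \<zeta>) ^ k) /
              of_nat N ^ CARD('n))"

text \<open>
  The index $(k_1,\dots,k_r)$, equivalently the word $e_{k_1}\cdots e_{k_r}$, is the list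
  \<open>[k\<^sub>1, \<dots>, k\<^sub>r]\<close> of positive integers. These words are a basis of $\mathfrak{H}^1$, whose
  elements are thus finitely supported rational-valued functions on lists.
\<close>

type_synonym index = "nat list"
type_synonym H1 = "index \<Rightarrow>\<^sub>0 rat"

definition Li :: "index \<Rightarrow> 'a \<Rightarrow> 'a::nonarch_complete_field" where
  "Li ks t =
     (\<Sum>\<^sub>\<infinity>ms\<in>{ms :: nat list. length ms = length ks \<and> sorted_wrt (<) ms \<and> (\<forall>m\<in>set ms. 0 < m)}.
        t ^ last ms / (\<Prod>i<length ks. of_nat (ms ! i) ^ (ks ! i)))"

definition word :: "index \<Rightarrow> H1" where
  "word u = Poly_Mapping.single u 1"

definition lmult_e :: "nat \<Rightarrow> H1 \<Rightarrow> H1" where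
  "lmult_e k w = (\<Sum>u\<in>Poly_Mapping.keys w. Poly_Mapping.single (k # u) (Poly_Mapping.lookup w u))"

fun harmonic_word :: "index \<Rightarrow> index \<Rightarrow> H1" where
  "harmonic_word [] w = word w"
| "harmonic_word v [] = word v"
| "harmonic_word (k # v) (l # w) =
     lmult_e k (harmonic_word v (l # w)) +
     lmult_e l (harmonic_word (k # v) w) +
     lmult_e (k + l) (harmonic_word v w)"

definition harmonic :: "H1 \<Rightarrow> H1 \<Rightarrow> H1" (infixl \<open>\<^bold>*\<close> 70) where
  "v \<^bold>* w =
     (\<Sum>a\<in>Poly_Mapping.keys v. \<Sum>b\<in>Poly_Mapping.keys w.
        Poly_Mapping.map (\<lambda>c. Poly_Mapping.lookup v a * Poly_Mapping.lookup w b * c)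
          (harmonic_word a b))"

definition Li_append2 :: "H1 \<Rightarrow> 'a \<Rightarrow> 'a::nonarch_complete_field" where
  "Li_append2 w t =
     (\<Sum>u\<in>Poly_Mapping.keys w. of_rat (Poly_Mapping.lookup w u) * Li (u @ [2]) t)"

end

theory Submission
  imports Defs
begin

text \<open>
  For a root of unity $\zeta$ of order prime to $p$ one has
  $\log_p((\zeta-\alpha)(\zeta-\beta)) = \log_p\alpha + \log(1-\zeta/\alpha) + \log(1-\beta/\zeta)$,
  and the last two terms are power series in $\zeta$ and $\zeta^{-1}$ that converge uniformly on the
  unit circle. By orthogonality of roots of unity the mean over $\mu_N$ of
  $\log^i(1-\zeta/\alpha)\log^j(1-\beta/\zeta)$ tends to the constant term of the product of the two
  series. Since $(-\log(1-X))^i/i!$ has $n$-th coefficient $n^{-1}$ times the truncated harmonic sum of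
  index $\{1\}^{i-1}$ below $n$, and truncated sums multiply by the harmonic product, this
  constant term is $(-1)^{i+j}i!\,j!\operatorname{Li}_{(\{1\}^{i-1}\ast\{1\}^{j-1},2)}(\beta/\alpha)$; the
  trinomial expansion gives the formula.

  Additivity of the logarithm on principal units comes from
  $\log u = \lim_n (u^{p^n}-1)/p^n$.
\<close>

section \<open>Non-archimedean absolute values\<close>

text \<open>The definition of \<open>log_p\<close> picks the component in \<open>U0\<close> by a
  definite description, so nothing can be computed from it until the decomposition is known to exist
  and to be unique. Existence rests on the density of \<open>Qp_bar\<close>: it reduces the claim to
  elements algebraic over \<open>Qp\<close>, whose absolute values are rational powers of p and
  whose nonzero residues have finite order. Uniqueness comes from absolute values together with the
  fact that no nontrivial root of unity of order prime to p lies in \<open>U0\<close>. The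
  coefficients 1/n are not p-adically bounded, but
  \<open>absval (1 / of_nat n) \<le> real n\<close>, so the power series involved have coefficients
  of polynomial growth and converge on the open unit disc by comparison with a geometric sequence.
  For N prime to p the integer N is a unit, so dividing by N does not enlarge errors.\<close>

lemma absval_nonneg [simp]: "0 \<le> absval x"
  using zero_le_dist[of x 0] by (simp add: dist_absval)

lemma absval_0 [simp]: "absval (0::'a::nonarch_complete_field) = 0"
  by (metis dist_absval dist_self diff_self)

lemma absval_eq_0_iff [simp]: "absval x = 0 \<longleftrightarrow> x = 0"
  using dist_eq_0_iff[of x 0] by (simp add: dist_absval)

lemma absval_pos_iff [simp]: "0 < absval x \<longleftrightarrow> x \<noteq> 0"
  using absval_nonneg[of x] absval_eq_0_iff[of x] by (simp del: absval_eq_0_iff absval_nonneg add: less_le)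

lemma absval_1 [simp]: "absval (1::'a::nonarch_complete_field) = 1"
proof -
  have "absval (1::'a) * absval (1::'a) = absval (1::'a)" using absval_mult[of "1::'a" 1] by simp
  thus ?thesis by simp
qed

lemma absval_minus [simp]: "absval (- x) = absval x"
  using dist_commute[of x 0] by (simp add: dist_absval)

lemma absval_minus_commute: "absval (x - y) = absval (y - x)"
  using dist_commute[of x y] by (simp add: dist_absval)

lemma absval_power: "absval (x ^ n) = absval x ^ n"
  by (induction n) (simp_all add: absval_mult)

lemma absval_inverse: "absval (inverse x) = inverse (absval x)"
proof (cases "x = 0")
  case False
  hence "absval x * absval (inverse x) = 1"
    by (simp flip: absval_mult)
  with False show ?thesis
    by (metis inverse_unique)
qed auto

lemma absval_divide: "absval (x / y) = absval x / absval y"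
  by (simp add: divide_inverse absval_mult absval_inverse)

lemma absval_prod: "absval (prod f A) = (\<Prod>x\<in>A. absval (f x))"
  by (induction A rule: infinite_finite_induct) (auto simp: absval_mult)

lemma absval_add_le: "absval x \<le> c \<Longrightarrow> absval y \<le> c \<Longrightarrow> absval (x + y) \<le> c"
  using absval_ultrametric[of x y] by linarith

lemma absval_diff_le: "absval x \<le> c \<Longrightarrow> absval y \<le> c \<Longrightarrow> absval (x - y) \<le> c"
  using absval_add_le[of x c "- y"] by simp

lemma absval_add_less: "absval x < c \<Longrightarrow> absval y < c \<Longrightarrow> absval (x + y) < c"
  using absval_ultrametric[of x y] by linarith

lemma absval_diff_less: "absval x < c \<Longrightarrow> absval y < c \<Longrightarrow> absval (x - y) < c"
  using absval_add_less[of x c "- y"] by simp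

lemma absval_diff_trans_less:
  "absval (x - y) < c \<Longrightarrow> absval (y - z) < c \<Longrightarrow> absval (x - z) < c"
  using absval_add_less[of "x - y" c "y - z"] by simp

lemma absval_sum_le:
  assumes "0 \<le> c" "\<And>x. x \<in> A \<Longrightarrow> absval (f x) \<le> c"
  shows "absval (sum f A) \<le> c"
  using assms by (induction A rule: infinite_finite_induct) (auto intro!: absval_add_le)

lemma absval_sum_less:
  assumes "0 < c" "\<And>x. x \<in> A \<Longrightarrow> absval (f x) < c"
  shows "absval (sum f A) < c"
  using assms by (induction A rule: infinite_finite_induct) (auto intro!: absval_add_less)

text \<open>Isosceles principle. It transfers absolute values to nearby elements of a dense
  subset.\<close>

lemma absval_eq_if_close:
  assumes "absval (x - y) < absval x"
  shows "absval y = absval x"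
proof (rule antisym)
  show "absval y \<le> absval x"
    using absval_diff_le[of x "absval x" "x - y"] assms by simp
  show "absval x \<le> absval y"
    using absval_ultrametric[of "x - y" y] assms by (auto simp: max_def split: if_splits)
qed

lemma absval_of_nat_le_1: "absval (of_nat n) \<le> 1"
  by (induction n) (auto intro: absval_add_le)

lemma absval_of_int_le_1: "absval (of_int k) \<le> 1"
  using absval_of_nat_le_1 by (cases k rule: int_cases2) auto

lemma absval_power_diff_le:
  assumes "absval x \<le> 1" "absval y \<le> 1"
  shows "absval (x ^ n - y ^ n) \<le> absval (x - y)"
proof (induction n)
  case (Suc n)
  have "x ^ Suc n - y ^ Suc n = x * (x ^ n - y ^ n) + (x - y) * y ^ n"
    by (simp add: field_simps)
  also have "absval \<dots> \<le> absval (x - y)"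
  proof (rule absval_add_le)
    show "absval (x * (x ^ n - y ^ n)) \<le> absval (x - y)"
      using mult_mono[of "absval x" 1 "absval (x ^ n - y ^ n)" "absval (x - y)"] Suc assms
      by (simp add: absval_mult)
    have "absval y ^ n \<le> 1" using assms by (intro power_le_one) auto
    thus "absval ((x - y) * y ^ n) \<le> absval (x - y)"
      using mult_left_mono[of "absval y ^ n" 1 "absval (x - y)"]
      by (simp add: absval_mult absval_power)
  qed
  finally show ?case .
qed auto

section \<open>Limits in terms of the absolute value, and continuity of the operations\<close>

lemma tendsto_absval_iff:
  fixes l :: "'a::nonarch_complete_field"
  shows "(f \<longlongrightarrow> l) F \<longleftrightarrow> ((\<lambda>x. absval (f x - l)) \<longlongrightarrow> 0) F"
  by (subst tendsto_dist_iff) (simp add: dist_absval)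

lemma tendsto_0_absval_iff:
  "(f \<longlongrightarrow> (0::'a::nonarch_complete_field)) F \<longleftrightarrow> ((\<lambda>x. absval (f x)) \<longlongrightarrow> 0) F"
  by (subst tendsto_absval_iff) simp

lemma tendsto_0_absval_le:
  fixes f :: "'b \<Rightarrow> 'a::nonarch_complete_field"
  assumes "(g \<longlongrightarrow> 0) F" "eventually (\<lambda>x. absval (f x) \<le> g x) F"
  shows "(f \<longlongrightarrow> 0) F"
  unfolding tendsto_0_absval_iff
  by (rule tendsto_sandwich[OF _ assms(2) tendsto_const assms(1)]) simp

text \<open>The class only provides a metric. This instance and the multiplicative one make the
  general limit lemmas for finite sums and products applicable.\<close>

instance nonarch_complete_field \<subseteq> topological_ab_group_add
proof
  fix a b :: 'a
  have *: "((\<lambda>x. (fst x + snd x) - (a + b)) \<longlongrightarrow> 0) (nhds a \<times>\<^sub>F nhds b)"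
  proof (rule tendsto_0_absval_le)
    show "((\<lambda>x. max (absval (fst x - a)) (absval (snd x - b))) \<longlongrightarrow> 0) (nhds a \<times>\<^sub>F nhds b)"
    proof -
      have "((\<lambda>x. absval (fst x - a)) \<longlongrightarrow> 0) (nhds a \<times>\<^sub>F nhds b)"
        unfolding tendsto_absval_iff[symmetric] by (rule filterlim_fst)
      moreover have "((\<lambda>x. absval (snd x - b)) \<longlongrightarrow> 0) (nhds a \<times>\<^sub>F nhds b)"
        unfolding tendsto_absval_iff[symmetric] by (rule filterlim_snd)
      ultimately show ?thesis using tendsto_max[of _ 0 _ _ 0] by fastforce
    qed
    show "\<forall>\<^sub>F x in nhds a \<times>\<^sub>F nhds b. absval (fst x + snd x - (a + b))
        \<le> max (absval (fst x - a)) (absval (snd x - b))"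
      by (intro always_eventually allI) (metis absval_ultrametric add_diff_add)
  qed
  show "((\<lambda>x. fst x + snd x) \<longlongrightarrow> a + b) (nhds a \<times>\<^sub>F nhds b)"
    using * by (simp only: tendsto_absval_iff[of _ "a + b"] tendsto_0_absval_iff)
  show "(uminus \<longlongrightarrow> - a) (nhds a)"
  proof -
    have "((\<lambda>x. absval (x - a)) \<longlongrightarrow> 0) (nhds a)"
      unfolding tendsto_absval_iff[symmetric] by (simp add: filterlim_ident)
    thus ?thesis
      by (subst tendsto_absval_iff) (simp add: absval_minus_commute)
  qed
qed

instance nonarch_complete_field \<subseteq> topological_comm_monoid_mult
proof
  fix a b :: 'a
  let ?F = "nhds a \<times>\<^sub>F nhds b"
  have 1: "((\<lambda>x. absval (fst x - a)) \<longlongrightarrow> 0) ?F"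
    unfolding tendsto_absval_iff[symmetric] by (rule filterlim_fst)
  have 2: "((\<lambda>x. absval (snd x - b)) \<longlongrightarrow> 0) ?F"
    unfolding tendsto_absval_iff[symmetric] by (rule filterlim_snd)
  have lim: "((\<lambda>x. max (absval (fst x - a) * absval (snd x - b))
          (max (absval (fst x - a) * absval b) (absval a * absval (snd x - b)))) \<longlongrightarrow>
        max (0 * 0) (max (0 * absval b) (absval a * 0))) ?F"
    by (intro tendsto_max tendsto_mult 1 2 tendsto_const)
  have "((\<lambda>x. fst x * snd x - a * b) \<longlongrightarrow> 0) ?F"
  proof (rule tendsto_0_absval_le)
    show "((\<lambda>x. max (absval (fst x - a) * absval (snd x - b))
          (max (absval (fst x - a) * absval b) (absval a * absval (snd x - b)))) \<longlongrightarrow> 0) ?F"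
      using lim by simp
    have "absval (x * y - a * b) \<le> max (absval (x - a) * absval (y - b))
          (max (absval (x - a) * absval b) (absval a * absval (y - b)))" for x y
    proof -
      have "x * y - a * b = (x - a) * (y - b) + ((x - a) * b + a * (y - b))"
        by (simp add: algebra_simps)
      also have "absval \<dots> \<le> max (absval ((x - a) * (y - b)))
          (max (absval ((x - a) * b)) (absval (a * (y - b))))"
        using absval_ultrametric[of "(x - a) * (y - b)"] absval_ultrametric[of "(x - a) * b"]
        by (meson max.mono order_refl order_trans)
      finally show ?thesis by (simp add: absval_mult)
    qed
    thus "\<forall>\<^sub>F x in ?F. absval (fst x * snd x - a * b) \<le>
        max (absval (fst x - a) * absval (snd x - b))
          (max (absval (fst x - a) * absval b) (absval a * absval (snd x - b)))"
      by (intro always_eventually allI) auto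
  qed
  thus "((\<lambda>x. fst x * snd x) \<longlongrightarrow> a * b) ?F"
    by (simp only: tendsto_absval_iff[of _ "a * b"] tendsto_0_absval_iff)
qed

lemma absval_le_limit:
  fixes f :: "nat \<Rightarrow> 'a::nonarch_complete_field"
  assumes "f \<longlonglongrightarrow> l" "eventually (\<lambda>n. absval (f n) \<le> c) sequentially"
  shows "absval l \<le> c"
proof -
  have "(\<lambda>n. dist (f n) 0) \<longlonglongrightarrow> dist l 0"
    by (intro tendsto_intros assms)
  hence "(\<lambda>n. absval (f n)) \<longlonglongrightarrow> absval l" by (simp add: dist_absval)
  from tendsto_upperbound[OF this assms(2)] show ?thesis by simp
qed

section \<open>Series\<close>

text \<open>A block of consecutive terms is no larger than its largest member, so terms tending to 0
  already make the partial sums Cauchy.\<close>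

lemma summable_nonarch:
  fixes f :: "nat \<Rightarrow> 'a::nonarch_complete_field"
  assumes "f \<longlonglongrightarrow> 0"
  shows "summable f"
proof -
  have lim: "(\<lambda>n. absval (f n)) \<longlonglongrightarrow> 0"
    using assms by (simp add: tendsto_0_absval_iff)
  have "Cauchy (\<lambda>n. sum f {..<n})"
  proof (rule metric_CauchyI)
    fix e :: real assume "0 < e"
    then obtain M where M: "\<And>m. m \<ge> M \<Longrightarrow> absval (f m) < e"
      using order_tendstoD(2)[OF lim] by (auto simp: eventually_sequentially)
    have *: "dist (sum f {..<m}) (sum f {..<n}) < e" if "m \<ge> M" "m \<le> n" for m n
    proof -
      have "sum f {..<n} - sum f {..<m} = sum f {m..<n}"
        using that by (simp add: sum_diff_nat_ivl atLeast0LessThan[symmetric])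
      moreover have "absval (sum f {m..<n}) < e"
        using that M \<open>0 < e\<close> by (intro absval_sum_less) auto
      ultimately show ?thesis by (simp add: dist_absval absval_minus_commute[of "sum f {..<m}"])
    qed
    show "\<exists>M. \<forall>m\<ge>M. \<forall>n\<ge>M. dist (sum f {..<m}) (sum f {..<n}) < e"
      using * by (metis dist_commute nle_le)
  qed
  thus ?thesis by (simp add: summable_iff_convergent Cauchy_convergent_iff)
qed

lemma absval_suminf_minus_partial_le:
  fixes f :: "nat \<Rightarrow> 'a::nonarch_complete_field"
  assumes "f sums s" "\<And>n. n \<ge> M \<Longrightarrow> absval (f n) \<le> c"
  shows "absval (s - sum f {..<M}) \<le> c"
proof (rule absval_le_limit)
  show "(\<lambda>n. sum f {..<n} - sum f {..<M}) \<longlonglongrightarrow> s - sum f {..<M}"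
    using assms(1) unfolding sums_def by (intro tendsto_intros)
  show "eventually (\<lambda>n. absval (sum f {..<n} - sum f {..<M}) \<le> c) sequentially"
    using eventually_ge_at_top[of M]
  proof eventually_elim
    case (elim n)
    have "0 \<le> c" using assms(2)[of M] absval_nonneg[of "f M"] by linarith
    have "sum f {..<n} - sum f {..<M} = sum f {M..<n}"
      using elim by (simp add: sum_diff_nat_ivl atLeast0LessThan[symmetric])
    also have "absval \<dots> \<le> c"
      using assms(2) \<open>0 \<le> c\<close> by (intro absval_sum_le) auto
    finally show ?case .
  qed
qed

lemma absval_sums_le:
  fixes f :: "nat \<Rightarrow> 'a::nonarch_complete_field"
  assumes "f sums s" "\<And>n. absval (f n) \<le> c"
  shows "absval s \<le> c"
  using absval_suminf_minus_partial_le[OF assms(1), of 0 c] assms(2) by simp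

lemma sums_mult_const:
  fixes f :: "nat \<Rightarrow> 'a::nonarch_complete_field"
  assumes "f sums s"
  shows "(\<lambda>n. c * f n) sums (c * s)"
  using tendsto_mult[OF tendsto_const[of c] assms[unfolded sums_def]]
  by (simp add: sums_def sum_distrib_left)

text \<open>Dominated convergence: since a tail is bounded by its largest term, the majorant
  \<open>b\<close> has to tend to 0 but need not be summable.\<close>

lemma tendsto_sums_nonarch:
  fixes f :: "nat \<Rightarrow> nat \<Rightarrow> 'a::nonarch_complete_field"
  assumes lim: "\<And>m. (\<lambda>k. f k m) \<longlonglongrightarrow> g m"
    and bound: "\<And>k m. absval (f k m) \<le> b m" and b: "b \<longlonglongrightarrow> 0"
    and sums: "\<And>k. f k sums s k" "g sums t"
  shows "s \<longlonglongrightarrow> t"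
proof (rule metric_LIMSEQ_I)
  fix e :: real assume e: "0 < e"
  obtain M where M: "\<And>m. m \<ge> M \<Longrightarrow> b m < e / 2"
    using order_tendstoD(2)[OF b, of "e / 2"] e by (auto simp: eventually_sequentially)
  have g: "absval (g m) \<le> b m" for m
    by (rule absval_le_limit[OF lim[of m]]) (simp add: bound)
  have "(\<lambda>k. \<Sum>m<M. f k m) \<longlonglongrightarrow> (\<Sum>m<M. g m)"
    by (intro tendsto_sum lim)
  then obtain K where K: "\<And>k. k \<ge> K \<Longrightarrow> dist (\<Sum>m<M. f k m) (\<Sum>m<M. g m) < e"
    using e by (auto simp: lim_sequentially)
  have "dist (s k) t < e" if "k \<ge> K" for k
  proof -
    have 1: "absval (s k - (\<Sum>m<M. f k m)) \<le> e / 2"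
      using bound M by (intro absval_suminf_minus_partial_le sums) (meson less_imp_le order_trans)
    have 2: "absval (t - (\<Sum>m<M. g m)) \<le> e / 2"
      using g M by (intro absval_suminf_minus_partial_le sums) (meson less_imp_le order_trans)
    have "s k - t = (s k - (\<Sum>m<M. f k m)) + ((\<Sum>m<M. f k m) - (\<Sum>m<M. g m))
        - (t - (\<Sum>m<M. g m))" by simp
    also have "absval \<dots> < e"
      using 1 2 K[OF that] e
      by (intro absval_diff_less[OF absval_add_less]) (linarith | simp add: dist_absval)+
    finally show ?thesis by (simp add: dist_absval)
  qed
  thus "\<exists>K. \<forall>k\<ge>K. dist (s k) t < e" by blast
qed

lemma tendsto_0_absval_bounded:
  fixes a b :: "nat \<Rightarrow> 'a::nonarch_complete_field"
  assumes "a \<longlonglongrightarrow> 0" "b \<longlonglongrightarrow> 0"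
  obtains K where "K > 0" "\<And>n. absval (a n) \<le> K" "\<And>n. absval (b n) \<le> K"
proof -
  have "Bseq (\<lambda>n. absval (a n))" "Bseq (\<lambda>n. absval (b n))"
    using assms unfolding tendsto_0_absval_iff by (auto intro: convergent_imp_Bseq convergentI)
  then obtain K1 K2 where "K1 > 0" "\<forall>n. absval (a n) \<le> K1" "\<forall>n. absval (b n) \<le> K2"
    by (auto elim!: BseqE)
  thus thesis by (intro that[of "max K1 K2"]) (auto simp: le_max_iff_disj)
qed

text \<open>The square i, j < M minus the triangle i + j < M contributes only products in which one
  index is at least M/2; that factor is small and the other one is bounded.\<close>

lemma sums_Cauchy_product_nonarch:
  fixes a b :: "nat \<Rightarrow> 'a::nonarch_complete_field"
  assumes a: "a \<longlonglongrightarrow> 0" "a sums A" and b: "b \<longlonglongrightarrow> 0" "b sums B"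
  shows "(\<lambda>n. \<Sum>i\<le>n. a i * b (n - i)) sums (A * B)"
proof -
  define S where "S = (\<lambda>M. \<Sum>n<M. \<Sum>i\<le>n. a i * b (n - i))"
  define T where "T = (\<lambda>M. (\<Sum>i<M. a i) * (\<Sum>j<M. b j))"
  have diff: "T M - S M = (\<Sum>(i, j)\<in>({..<M} \<times> {..<M}) - {(i, j). i + j < M}. a i * b j)" for M
  proof -
    have "S M = (\<Sum>(i, j)\<in>{(i, j). i + j < M}. a i * b j)"
      unfolding S_def by (rule sum.triangle_reindex[symmetric])
    moreover have "T M = (\<Sum>(i, j)\<in>{..<M} \<times> {..<M}. a i * b j)"
      unfolding T_def by (simp add: sum_product sum.cartesian_product)
    ultimately show ?thesis by (subst sum_diff) auto
  qed
  obtain K where K: "K > 0" "\<And>n. absval (a n) \<le> K" "\<And>n. absval (b n) \<le> K"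
    using tendsto_0_absval_bounded[OF a(1) b(1)] by blast
  have "(\<lambda>M. T M - S M) \<longlonglongrightarrow> 0"
  proof (rule metric_LIMSEQ_I)
    fix e :: real assume e: "0 < e"
    have "eventually (\<lambda>n. absval (a n) < e / 2 / K \<and> absval (b n) < e / 2 / K) sequentially"
      using a(1) b(1) K(1) e unfolding tendsto_0_absval_iff
      by (intro eventually_conj order_tendstoD(2)) auto
    then obtain M where M: "\<And>n. n \<ge> M \<Longrightarrow> absval (a n) < e / 2 / K \<and> absval (b n) < e / 2 / K"
      by (auto simp: eventually_sequentially)
    have "dist (T n - S n) 0 < e" if "n \<ge> 2 * M" for n
    proof -
      have "absval (a i * b j) \<le> e / 2" if "n \<le> i + j" for i j
      proof -
        consider "i \<ge> M" | "j \<ge> M" using \<open>n \<ge> 2 * M\<close> \<open>n \<le> i + j\<close> by linarith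
        thus ?thesis
        proof cases
          case 1
          thus ?thesis using mult_mono[of "absval (a i)" "e / 2 / K" "absval (b j)" K] M[of i] K e
            by (simp add: absval_mult)
        next
          case 2
          thus ?thesis using mult_mono[of "absval (a i)" K "absval (b j)" "e / 2 / K"] M[of j] K e
            by (simp add: absval_mult)
        qed
      qed
      hence "absval (T n - S n) \<le> e / 2"
        unfolding diff using e by (intro absval_sum_le) auto
      thus ?thesis using e by (simp add: dist_absval)
    qed
    thus "\<exists>M. \<forall>n\<ge>M. dist (T n - S n) 0 < e" by blast
  qed
  moreover have "T \<longlonglongrightarrow> A * B"
    unfolding T_def using a(2) b(2) by (intro tendsto_mult) (auto simp: sums_def)
  ultimately have "(\<lambda>M. T M - (T M - S M)) \<longlonglongrightarrow> A * B - 0"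
    by (intro tendsto_diff)
  thus ?thesis by (simp add: sums_def S_def)
qed

text \<open>Once all terms outside \<open>S M\<close> are small, adding any finite set of them moves
  the sum by less than e. An unordered sum, such as the one over lists in \<open>Li\<close>, can
  thus be evaluated along a convenient exhaustion.\<close>

lemma has_sum_exhaustion_nonarch:
  fixes f :: "'i \<Rightarrow> 'a::nonarch_complete_field"
  assumes S: "\<And>M. finite (S M)" "\<And>M. S M \<subseteq> I"
    and bound: "\<And>e. 0 < e \<Longrightarrow> eventually (\<lambda>M. \<forall>i\<in>I - S M. absval (f i) < e) sequentially"
    and lim: "(\<lambda>M. sum f (S M)) \<longlonglongrightarrow> l"
  shows "(f has_sum l) I"
  unfolding has_sum_def
proof (rule tendstoI)
  fix e :: real assume e: "0 < e"
  have "eventually (\<lambda>M. (\<forall>i\<in>I - S M. absval (f i) < e) \<and> dist (sum f (S M)) l < e) sequentially"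
    using bound[OF e] tendstoD[OF lim e] by (rule eventually_conj)
  then obtain M where M: "\<forall>i\<in>I - S M. absval (f i) < e" "dist (sum f (S M)) l < e"
    by (auto simp: eventually_sequentially)
  have "dist (sum f F) l < e" if "finite F" "S M \<subseteq> F" "F \<subseteq> I" for F
  proof -
    have "absval (sum f (F - S M)) < e"
    proof (rule absval_sum_less[OF e])
      fix x assume "x \<in> F - S M"
      thus "absval (f x) < e" using M(1) that by auto
    qed
    moreover have "sum f F - l = (sum f (S M) - l) + sum f (F - S M)"
      using that by (subst sum.subset_diff[of "S M" F f]) auto
    ultimately show ?thesis
      using M(2) absval_add_less by (metis dist_absval)
  qed
  thus "eventually (\<lambda>F. dist (sum f F) l < e) (finite_subsets_at_top I)"
    unfolding eventually_finite_subsets_at_top by (intro exI[of _ "S M"]) (simp add: S)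
qed

lemma power_times_geometric_tendsto_0:
  fixes r :: real
  assumes "0 \<le> r" "r < 1"
  shows "(\<lambda>n. real n ^ d * r ^ n) \<longlonglongrightarrow> 0"
  using assms
proof (induction d arbitrary: r)
  case 0
  thus ?case by (simp add: LIMSEQ_realpow_zero)
next
  case (Suc d)
  \<comment> \<open>With \<open>r = s * s\<close>, one factor \<open>s ^ n\<close> absorbs one power
    of n and the other is left for the induction hypothesis, which is therefore stated for arbitrary
    \<open>r\<close>.\<close>
  define s where "s = sqrt r"
  have s: "0 \<le> s" "s < 1" "r = s * s" using Suc.prems by (auto simp: s_def)
  have "(\<lambda>n. (real n * s ^ n) * (real n ^ d * s ^ n)) \<longlonglongrightarrow> 0 * 0"
    using s by (intro tendsto_mult powser_times_n_limit_0 Suc.IH) auto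
  thus ?case by (simp add: s(3) power_mult_distrib mult_ac)
qed

section \<open>The absolute value of integers\<close>

locale padic_field =
  fixes p :: nat and ty :: "'a::nonarch_complete_field itself"
  assumes prime_p: "prime p"
    and absval_p: "absval (of_nat p :: 'a) = 1 / real p"
begin

lemma p_gt_1: "p > 1"
  using prime_p by (rule prime_gt_1_nat)

text \<open>In a Bezout relation a k + b p = 1 the second term is smaller than 1; if k were smaller
  than 1 as well, so would be the sum.\<close>

lemma absval_of_int_coprime:
  assumes "coprime k (int p)"
  shows "absval (of_int k :: 'a) = 1"
proof -
  obtain a b :: int where ab: "a * k + b * int p = 1"
    using bezout_int[of k "int p"] assms by auto
  hence "of_int (a * k + b * int p) = (1::'a)" by simp
  hence eq: "of_int a * of_int k + of_int b * of_nat p = (1::'a)" by simp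
  have "1 \<le> absval (of_int k :: 'a)"
  proof (rule ccontr)
    assume "\<not> ?thesis"
    hence less: "absval (of_int k :: 'a) < 1" by simp
    have "absval (of_int a * of_int k :: 'a) < 1"
      using le_less_trans[OF mult_right_mono[OF absval_of_int_le_1[of a, where ?'a = 'a]
          absval_nonneg[of "of_int k :: 'a"]]] less
      by (simp only: absval_mult mult_1)
    moreover have "absval (of_int b * of_nat p :: 'a) < 1"
      using le_less_trans[OF mult_right_mono[OF absval_of_int_le_1[of b, where ?'a = 'a]
          absval_nonneg[of "of_nat p :: 'a"]], of 1] p_gt_1
      by (simp add: absval_mult absval_p)
    ultimately show False
      using absval_add_less[of "of_int a * of_int k :: 'a" 1 "of_int b * of_nat p"] eq by simp
  qed
  with absval_of_int_le_1[of k, where ?'a = 'a] show ?thesis by simp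
qed

lemma absval_of_nat_coprime: "coprime n p \<Longrightarrow> absval (of_nat n :: 'a) = 1"
  using absval_of_int_coprime[of "int n"] by simp

lemma absval_of_nat_exists:
  assumes "n > 0"
  obtains k m where "n = m * p ^ k" "coprime m p" "absval (of_nat n :: 'a) = 1 / real p ^ k"
proof -
  obtain k m where km: "\<not> p dvd m" "n = m * p ^ k"
    using prime_power_canonical[OF prime_p assms] by blast
  hence "coprime m p" using prime_p by (metis coprime_commute prime_imp_coprime)
  with km that[of m k] show thesis
    by (simp add: absval_mult absval_power absval_p absval_of_nat_coprime power_one_over)
qed

text \<open>The power of p dividing n is at most n. The polynomial growth bounds below rest on this;
  at n = 0 the convention \<open>1 / 0 = 0\<close> applies.\<close>

lemma absval_inverse_of_nat_le: "absval (1 / of_nat n :: 'a) \<le> real n"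
proof (cases "n = 0")
  case False
  then obtain k m where km: "n = m * p ^ k" "absval (of_nat n :: 'a) = 1 / real p ^ k"
    using absval_of_nat_exists[of n] by blast
  hence "p ^ k \<le> n" using False by simp
  hence "real p ^ k \<le> real n" by (metis of_nat_le_iff of_nat_power)
  thus ?thesis by (simp add: absval_divide km(2))
qed auto

lemma tendsto_poly_geometric:
  fixes x :: 'a
  assumes "absval x < 1" "\<And>n. absval (a n) \<le> real n ^ d"
  shows "(\<lambda>n. a n * x ^ n) \<longlonglongrightarrow> 0"
proof (rule tendsto_0_absval_le)
  show "(\<lambda>n. real n ^ d * absval x ^ n) \<longlonglongrightarrow> 0"
    using assms by (intro power_times_geometric_tendsto_0) auto
  show "\<forall>\<^sub>F n in sequentially. absval (a n * x ^ n) \<le> real n ^ d * absval x ^ n"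
    using assms(2) by (intro always_eventually allI) (simp add: absval_mult absval_power mult_right_mono)
qed

section \<open>The logarithm on the principal units\<close>

lemma log_coeff_tendsto_0:
  fixes x :: 'a
  assumes "absval x < 1"
  shows "(\<lambda>n. 1 / of_nat n * x ^ n) \<longlonglongrightarrow> 0"
  using tendsto_poly_geometric[OF assms, of "\<lambda>n. 1 / of_nat n" 1] absval_inverse_of_nat_le
  by (simp only: power_one_right)

text \<open>The series of \<open>log_p\<close> at an argument that is its own component in
  \<open>U0\<close>; it can be studied before the decomposition is available.\<close>

definition plog :: "'a \<Rightarrow> 'a" where
  "plog u = suminf (\<lambda>n. (-1) ^ n / of_nat (Suc n) * (u - 1) ^ Suc n)"

lemma plog_sums:
  assumes "u \<in> U0"
  shows "(\<lambda>n. (-1) ^ n / of_nat (Suc n) * (u - 1) ^ Suc n) sums plog u"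
proof -
  have "(\<lambda>n. 1 / of_nat (Suc n) * (u - 1) ^ Suc n) \<longlonglongrightarrow> 0"
    using LIMSEQ_Suc[OF log_coeff_tendsto_0[of "u - 1"]] assms by (simp add: U0_def)
  hence "(\<lambda>n. (-1) ^ n / of_nat (Suc n) * (u - 1) ^ Suc n) \<longlonglongrightarrow> 0"
    by (simp add: tendsto_0_absval_iff absval_mult absval_divide absval_power)
  thus ?thesis unfolding plog_def by (intro summable_sums summable_nonarch)
qed

lemma plog_1_minus_sums:
  assumes "absval x < 1"
  shows "(\<lambda>n. 1 / of_nat n * x ^ n) sums (- plog (1 - x))"
proof -
  have "(\<lambda>n. (-1) ^ n / of_nat (Suc n) * ((1 - x) - 1) ^ Suc n) sums plog (1 - x)"
    using assms by (intro plog_sums) (simp add: U0_def)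
  also have "(\<lambda>n. (-1) ^ n / of_nat (Suc n) * ((1 - x) - 1) ^ Suc n) =
      (\<lambda>n. - (1 / of_nat (Suc n) * x ^ Suc n))"
  proof
    fix n
    have "(-1) ^ n * (- x) ^ n = x ^ n" by (simp flip: power_mult_distrib)
    thus "(-1) ^ n / of_nat (Suc n) * ((1 - x) - 1) ^ Suc n = - (1 / of_nat (Suc n) * x ^ Suc n)"
      by (simp add: mult.commute mult.left_commute)
  qed
  finally have "(\<lambda>n. - (1 / of_nat (Suc n) * x ^ Suc n)) sums plog (1 - x)" .
  from sums_mult_const[OF this, of "-1"] have
    "(\<lambda>n. 1 / of_nat (Suc n) * x ^ Suc n) sums (- plog (1 - x))"
    by (simp only: mult_minus1 minus_minus)
  \<comment> \<open>The index shifts from \<open>Suc n\<close> to n at no cost: the new term at n =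
    0 is \<open>1 / 0 * 1 = 0\<close>.\<close>
  from sums_Suc[OF this] show ?thesis by simp
qed

lemma p_power_tendsto_0: "(\<lambda>k. of_nat (p ^ k) :: 'a) \<longlonglongrightarrow> 0"
proof -
  have "(\<lambda>k. (1 / real p) ^ k) \<longlonglongrightarrow> 0"
    using p_gt_1 by (intro LIMSEQ_realpow_zero) auto
  thus ?thesis by (simp add: tendsto_0_absval_iff absval_power absval_p)
qed

text \<open>With z = u - 1 and q = p^k, the binomial theorem writes (u^q - 1)/q as the sum over m of
  C(q-1, m)/(m+1) z^(m+1). As q tends to 0 p-adically, C(q-1, m) tends to C(-1, m) = (-1)^m.
  Binomial coefficients are integers, so the terms are dominated by those of the logarithm
  series.\<close>

lemma plog_eq_limit:
  assumes "u \<in> U0"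
  shows "(\<lambda>k. (u ^ (p ^ k) - 1) / of_nat (p ^ k)) \<longlonglongrightarrow> plog u"
proof -
  define z where "z = u - 1"
  have z: "absval z < 1" using assms by (simp add: U0_def z_def)
  define f where "f = (\<lambda>k m. of_nat ((p ^ k - 1) choose m) / of_nat (Suc m) * z ^ Suc m)"
  show ?thesis
  proof (rule tendsto_sums_nonarch[of f])
    show "(\<lambda>n. (-1) ^ n / of_nat (Suc n) * z ^ Suc n) sums plog u"
      unfolding z_def by (rule plog_sums[OF assms])
    show "absval (f k m) \<le> absval (1 / of_nat (Suc m) * z ^ Suc m)" for k m
      using mult_right_mono[OF absval_of_nat_le_1[of "(p ^ k - 1) choose m", where ?'a = 'a],
          of "absval (1 / of_nat (Suc m) * z ^ Suc m)"]
      by (simp add: f_def absval_mult absval_divide del: of_nat_Suc)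
    show "(\<lambda>m. absval (1 / of_nat (Suc m) * z ^ Suc m)) \<longlonglongrightarrow> 0"
      using LIMSEQ_Suc[OF log_coeff_tendsto_0[OF z]] unfolding tendsto_0_absval_iff .
    show "(\<lambda>k. f k m) \<longlonglongrightarrow> (-1) ^ m / of_nat (Suc m) * z ^ Suc m" for m
    proof -
      have "of_nat (p ^ k - 1) = (of_nat (p ^ k) - 1 :: 'a)" for k
        using p_gt_1 by (subst of_nat_diff) auto
      hence "(\<lambda>k. of_nat (p ^ k - 1) :: 'a) \<longlonglongrightarrow> 0 - 1"
        using tendsto_diff[OF p_power_tendsto_0 tendsto_const[of "1::'a"]] by simp
      \<comment> \<open>For fixed m the binomial coefficient is a polynomial in its upper entry,
        hence continuous.\<close>
      hence "(\<lambda>k. (\<Prod>i=0..<m. of_nat (p ^ k - 1) - of_nat i) * (1 / fact m) :: 'a)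
          \<longlonglongrightarrow> (\<Prod>i=0..<m. 0 - 1 - of_nat i) * (1 / fact m)"
        by (intro tendsto_mult tendsto_prod' tendsto_diff tendsto_const)
      also have "(\<lambda>k. (\<Prod>i=0..<m. of_nat (p ^ k - 1) - of_nat i) * (1 / fact m)) =
          (\<lambda>k. of_nat ((p ^ k - 1) choose m) :: 'a)"
        by (simp add: binomial_gbinomial gbinomial_prod_rev)
      also have "(\<Prod>i=0..<m. 0 - 1 - of_nat i) * (1 / fact m) = ((-1::'a) gchoose m)"
        by (simp add: gbinomial_prod_rev)
      also have "\<dots> = (-1) ^ m"
        using gbinomial_minus[of "1::'a" m] by (simp flip: binomial_gbinomial)
      finally have lim: "(\<lambda>k. of_nat ((p ^ k - 1) choose m) :: 'a) \<longlonglongrightarrow> (-1) ^ m" .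
      show ?thesis
        using tendsto_mult[OF lim tendsto_const[of "1 / of_nat (Suc m) * z ^ Suc m"]]
        by (simp add: f_def)
    qed
    show "f k sums ((u ^ (p ^ k) - 1) / of_nat (p ^ k))" for k
    proof -
      obtain q where q: "p ^ k = Suc q" using p_gt_1 by (cases "p ^ k") auto
      have "u ^ Suc q = (z + 1) ^ Suc q" by (simp add: z_def)
      also have "\<dots> = (\<Sum>m\<le>Suc q. of_nat (Suc q choose m) * z ^ m)"
        by (subst binomial_ring) simp
      also have "\<dots> = 1 + (\<Sum>m\<le>q. of_nat (Suc q choose Suc m) * z ^ Suc m)"
        by (subst sum.atMost_Suc_shift) simp
      finally have "(u ^ Suc q - 1) / of_nat (Suc q) =
          (\<Sum>m\<le>q. of_nat (Suc q choose Suc m) * z ^ Suc m) / of_nat (Suc q)" by simp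
      also have "\<dots> = (\<Sum>m\<le>q. f k m)"
        unfolding sum_divide_distrib
      proof (rule sum.cong[OF refl])
        fix m
        have "of_nat (Suc m) * of_nat (Suc q choose Suc m) = (of_nat (Suc q) * of_nat (q choose m) :: 'a)"
          using Suc_times_binomial[of m q] by (metis of_nat_mult)
        hence "of_nat (Suc q choose Suc m) / of_nat (Suc q) = (of_nat (q choose m) / of_nat (Suc m) :: 'a)"
          by (subst frac_eq_eq) (simp_all only: of_nat_eq_0_iff nat.simps mult.commute not_False_eq_True)
        thus "of_nat (Suc q choose Suc m) * z ^ Suc m / of_nat (Suc q) = f k m"
          unfolding f_def q diff_Suc_1 by (simp only: times_divide_eq_left[symmetric])
      qed
      finally have "(u ^ Suc q - 1) / of_nat (Suc q) = (\<Sum>m\<le>q. f k m)" .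
      moreover have "f k sums (\<Sum>m\<le>q. f k m)"
        by (rule sums_finite) (auto simp: f_def q)
      ultimately show ?thesis unfolding q by simp
    qed
  qed
qed

lemma U0_mult: "u \<in> U0 \<Longrightarrow> v \<in> U0 \<Longrightarrow> u * v \<in> (U0 :: 'a set)"
proof -
  assume u: "u \<in> U0" and v: "v \<in> U0"
  have "u * v - 1 = (u - 1) * (v - 1) + (u - 1) + (v - 1)" by (simp add: algebra_simps)
  also have "absval \<dots> < 1"
  proof (intro absval_add_less)
    show "absval ((u - 1) * (v - 1)) < 1"
      using u v mult_strict_mono'[of "absval (u - 1)" 1 "absval (v - 1)" 1]
      by (simp add: U0_def absval_mult)
  qed (use u v in \<open>auto simp: U0_def\<close>)
  finally show ?thesis by (simp add: U0_def)
qed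

text \<open>Put g(u) = (u^q - 1)/q with q = p^k. Then g(u v) = g(u) + g(v) + q g(u) g(v), and the
  last term disappears in the limit because q tends to 0.\<close>

lemma plog_mult:
  assumes u: "u \<in> U0" and v: "v \<in> U0"
  shows "plog (u * v) = plog u + plog v"
proof (rule LIMSEQ_unique)
  let ?q = "\<lambda>k. of_nat (p ^ k) :: 'a"
  let ?g = "\<lambda>u k. (u ^ (p ^ k) - 1) / of_nat (p ^ k) :: 'a"
  show "?g (u * v) \<longlonglongrightarrow> plog (u * v)" by (intro plog_eq_limit U0_mult u v)
  have "(\<lambda>k. ?g u k + ?g v k + ?q k * (?g u k * ?g v k)) \<longlonglongrightarrow>
      plog u + plog v + 0 * (plog u * plog v)"
    by (intro tendsto_add tendsto_mult plog_eq_limit u v p_power_tendsto_0)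
  also have "(\<lambda>k. ?g u k + ?g v k + ?q k * (?g u k * ?g v k)) = ?g (u * v)"
  proof
    fix k
    have alg: "(x - 1) / q + (y - 1) / q + q * ((x - 1) / q * ((y - 1) / q)) = (x * y - 1) / q"
      if "q \<noteq> 0" for x y q :: 'a
      using that by (simp add: divide_simps) (simp add: algebra_simps)
    have "?q k \<noteq> 0" using p_gt_1 by simp
    note alg[OF this]
    thus "?g u k + ?g v k + ?q k * (?g u k * ?g v k) = ?g (u * v) k"
      by (simp only: power_mult_distrib)
  qed
  finally show "?g (u * v) \<longlonglongrightarrow> plog u + plog v" by simp
qed

lemma plog_1 [simp]: "plog 1 = 0"
  by (simp add: plog_def)

text \<open>Used for p = 2, when -1 is a principal unit.\<close>

lemma plog_minus_1:
  assumes "(-1::'a) \<in> U0"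
  shows "plog (-1) = 0"
proof -
  have "plog (-1) + plog (-1) = 0"
    using plog_mult[OF assms assms] by simp
  hence "2 * plog (-1) = 0" by (simp only: mult_2)
  thus ?thesis by simp
qed

end

section \<open>Roots of unity\<close>

lemma power_gcd_eq_1:
  fixes z :: "'a::field"
  assumes "z ^ a = 1" "z ^ b = 1"
  shows "z ^ gcd a b = 1"
proof (cases "a = 0")
  case False
  then obtain x y where "a * x = b * y + gcd a b" using bezout_nat by blast
  hence "z ^ (a * x) = z ^ (b * y + gcd a b)" by simp
  thus ?thesis using assms by (simp add: power_add power_mult)
qed (use assms in auto)

lemma mu_eq_roots: "mu N = {z::'a::field. poly (monom 1 N - 1) z = 0}"
  by (simp add: mu_def poly_monom)

lemma degree_monom_minus_1: "degree (monom 1 N - 1 :: 'a::field poly) = N"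
proof (cases "N = 0")
  case False
  have "degree (monom (1::'a) N + (- 1)) = degree (monom (1::'a) N)"
    using False by (intro degree_add_eq_left) (simp add: degree_monom_eq)
  thus ?thesis by (simp add: degree_monom_eq)
qed simp

lemma
  assumes "N > 0"
  shows finite_mu: "finite (mu N :: 'a::field set)"
    and card_mu_le: "card (mu N :: 'a::field set) \<le> N"
proof -
  have "monom 1 N - 1 \<noteq> (0 :: 'a poly)"
    using degree_monom_minus_1[of N, where ?'a = 'a] assms by (metis degree_0 less_irrefl)
  from poly_roots_finite[OF this] card_poly_roots_bound[OF this]
  show "finite (mu N :: 'a set)" "card (mu N :: 'a set) \<le> N"
    unfolding mu_eq_roots by (simp_all add: degree_monom_minus_1)
qed

text \<open>If two products agree, the quotient of their first factors has order dividing both a and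
  b, hence is 1.\<close>

lemma card_mu_mult_ge:
  assumes "coprime a b" "a > 0" "b > 0"
  shows "card (mu a :: 'a::field set) * card (mu b :: 'a set) \<le> card (mu (a * b) :: 'a set)"
proof -
  have "card (mu a \<times> mu b :: ('a \<times> 'a) set) \<le> card (mu (a * b) :: 'a set)"
  proof (rule card_inj_on_le)
    show "inj_on (\<lambda>(x, y). x * y) (mu a \<times> mu b :: ('a \<times> 'a) set)"
    proof (rule inj_onI, clarify)
      fix x y x' y' :: 'a
      assume xy: "x \<in> mu a" "y \<in> mu b" "x' \<in> mu a" "y' \<in> mu b" and eq: "x * y = x' * y'"
      have nz: "x' \<noteq> 0" "y \<noteq> 0" using xy assms by (auto simp: mu_def power_0_left)
      hence "x / x' = y' / y" using eq by (simp add: field_simps)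
      moreover have "(x / x') ^ a = 1" "(y' / y) ^ b = 1"
        using xy by (auto simp: mu_def power_divide)
      ultimately have "x / x' = 1" "y' / y = 1"
        using power_gcd_eq_1[of "x / x'" a b] assms(1) by auto
      thus "x = x' \<and> y = y'" using nz by simp
    qed
    show "(\<lambda>(x, y). x * y) ` (mu a \<times> mu b) \<subseteq> (mu (a * b) :: 'a set)"
      by (auto simp: mu_def power_mult_distrib power_mult) (metis power_commutes power_mult mult.commute power_one)
    show "finite (mu (a * b) :: 'a set)" using assms by (intro finite_mu) auto
  qed
  thus ?thesis by (simp add: card_cartesian_product)
qed

text \<open>Multiplication by a root \<eta> permutes \<open>mu N\<close> and scales the sum by
  \<open>\<eta> ^ j\<close>, so one \<eta> with \<open>\<eta> ^ j \<noteq> 1\<close> suffices.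
  Without one, all N elements of \<open>mu N\<close> would have order dividing gcd(j, N) <
  N.\<close>

lemma sum_mu_power_eq_0:
  assumes "card (mu N :: 'a::field set) = N" "N > 0" "\<not> N dvd j"
  shows "(\<Sum>\<zeta>\<in>mu N. \<zeta> ^ j) = (0::'a)"
proof -
  have "\<exists>\<eta>\<in>mu N. \<eta> ^ j \<noteq> (1::'a)"
  proof (rule ccontr)
    assume "\<not> ?thesis"
    hence "mu N \<subseteq> (mu (gcd j N) :: 'a set)"
      using power_gcd_eq_1 by (auto simp: mu_def)
    hence "N \<le> gcd j N"
      using card_mono[OF finite_mu, of "gcd j N" "mu N :: 'a set"]
        card_mu_le[of "gcd j N", where ?'a = 'a] assms by simp
    hence "gcd j N = N" using assms(2) by (simp add: gcd_le2_nat le_antisym)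
    thus False using assms(3) by (metis gcd_dvd1)
  qed
  then obtain \<eta> :: 'a where \<eta>: "\<eta> \<in> mu N" "\<eta> ^ j \<noteq> 1" by blast
  have nz: "\<eta> \<noteq> 0" using \<eta> assms by (auto simp: mu_def power_0_left)
  have "bij_betw (\<lambda>\<zeta>. \<eta> * \<zeta>) (mu N) (mu N)"
    using \<eta>(1) nz by (intro bij_betwI[of _ _ _ "\<lambda>\<zeta>. \<zeta> / \<eta>"])
      (auto simp: mu_def power_mult_distrib power_divide)
  hence "(\<Sum>\<zeta>\<in>mu N. \<zeta> ^ j) = (\<Sum>\<zeta>\<in>mu N. (\<eta> * \<zeta>) ^ j)"
    by (rule sum.reindex_bij_betw[symmetric])
  also have "\<dots> = \<eta> ^ j * (\<Sum>\<zeta>\<in>mu N. \<zeta> ^ j)"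
    by (simp add: power_mult_distrib sum_distrib_left)
  finally have "(\<eta> ^ j - 1) * (\<Sum>\<zeta>\<in>mu N. \<zeta> ^ j) = 0" by (simp add: algebra_simps)
  thus ?thesis using \<eta>(2) by simp
qed

lemma sum_mu_orthogonality:
  assumes card: "card (mu N :: 'a::field set) = N" and "m < N" "n < N"
  shows "(\<Sum>\<zeta>\<in>mu N. \<zeta> ^ m * inverse \<zeta> ^ n) = (if m = n then of_nat N else (0::'a))"
proof -
  \<comment> \<open>The negative exponent is replaced by N - n, so that the sum over natural powers
    applies.\<close>
  have eq: "\<zeta> ^ m * inverse \<zeta> ^ n = \<zeta> ^ (m + (N - n))" if "\<zeta> \<in> mu N" for \<zeta> :: 'a
  proof -
    have "\<zeta> \<noteq> 0" using that assms by (auto simp: mu_def power_0_left)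
    moreover have "\<zeta> ^ n * \<zeta> ^ (N - n) = 1"
      using that assms by (simp add: mu_def flip: power_add)
    ultimately show ?thesis by (simp add: power_add field_simps)
  qed
  have "(\<Sum>\<zeta>\<in>mu N. \<zeta> ^ m * inverse \<zeta> ^ n) = (\<Sum>\<zeta>\<in>mu N. \<zeta> ^ (m + (N - n)) :: 'a)"
    by (intro sum.cong refl eq)
  also have "\<dots> = (if m = n then of_nat N else (0::'a))"
  proof (cases "m = n")
    case True
    thus ?thesis using assms by (simp add: mu_def)
  next
    case False
    \<comment> \<open>The exponent lies strictly between 0 and 2N, so it can be a multiple of N only
      by being N itself.\<close>
    have "\<not> N dvd m + (N - n)"
    proof
      assume "N dvd m + (N - n)"
      then obtain k where k: "m + (N - n) = N * k" by blast
      have "N * k < N * 2" "0 < N * k" using assms unfolding k[symmetric] by linarith+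
      hence "k = 1" by simp
      thus False using k False assms by simp
    qed
    thus ?thesis using False assms by (simp add: sum_mu_power_eq_0)
  qed
  finally show ?thesis .
qed

section \<open>Existence of all roots of unity\<close>

locale Cp_field = padic_field p ty
  for p :: nat and ty :: "'a::nonarch_complete_field itself" +
  fixes pw :: "rat \<Rightarrow> 'a"
  assumes alg_closed: "alg_closed_subset (Qp_bar :: 'a set)"
    and dense: "closure (Qp_bar :: 'a set) = UNIV"
    and p_power: "is_p_power p pw"
begin

text \<open>\<open>alg_closed\<close> concerns polynomials over \<open>Qp_bar\<close>, which
  contains the rationals as roots of linear polynomials. Rational coefficients are all that the
  construction of roots of unity requires.\<close>

lemma rational_poly_has_root:
  fixes f :: "'a poly"
  assumes "\<And>i. poly.coeff f i \<in> \<rat>" "degree f > 0"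
  shows "\<exists>x. poly f x = 0"
proof -
  have "c \<in> Qp_bar" if "c \<in> \<rat>" for c :: 'a
  proof -
    have "poly.coeff [:- c, 1:] i \<in> \<rat>" for i
      using that by (auto simp: coeff_pCons split: nat.splits)
    hence "\<forall>i. poly.coeff [:- c, 1:] i \<in> Qp"
      using closure_subset unfolding Qp_def by blast
    thus ?thesis unfolding Qp_bar_def algebraic_over_def
      by (intro CollectI exI[of _ "[:- c, 1:]"]) auto
  qed
  thus ?thesis using alg_closed assms unfolding alg_closed_subset_def by blast
qed

text \<open>\<open>P\<close> is the cyclotomic polynomial (X^(q^(e+1)) - 1) / (X^(q^e) - 1). Where
  X^(q^e) = 1 it takes the value q, which is nonzero in characteristic 0, so its roots have exact
  order q^(e+1).\<close>

lemma root_of_unity_prime_power: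
  assumes "prime q"
  shows "\<exists>\<zeta>::'a. \<zeta> ^ (q ^ Suc e) = 1 \<and> \<zeta> ^ (q ^ e) \<noteq> 1"
proof -
  define P :: "'a poly" where "P = (\<Sum>i<q. monom 1 (i * q ^ e))"
  have q: "q > 1" using assms by (rule prime_gt_1_nat)
  have coeff: "poly.coeff P n = (\<Sum>i<q. if i * q ^ e = n then 1 else 0)" for n
    by (simp add: P_def coeff_sum)
  have "poly.coeff P ((q - 1) * q ^ e) = (\<Sum>i<q. if i = q - 1 then 1 else 0)"
    unfolding coeff using q by (intro sum.cong) auto
  hence "poly.coeff P ((q - 1) * q ^ e) \<noteq> 0" using q by simp
  hence "(q - 1) * q ^ e \<le> degree P" by (rule le_degree)
  moreover have "0 < (q - 1) * q ^ e" using q by simp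
  ultimately have "degree P > 0" by linarith
  moreover have "poly.coeff P n \<in> \<rat>" for n
    unfolding coeff by (intro Rats_sum) auto
  ultimately obtain \<zeta> where "poly P \<zeta> = 0" using rational_poly_has_root by blast
  hence sum0: "(\<Sum>i<q. (\<zeta> ^ (q ^ e)) ^ i) = 0"
    by (simp add: P_def poly_sum poly_monom power_mult[symmetric] mult.commute)
  hence "(\<zeta> ^ (q ^ e)) ^ q - 1 = 0" by (simp add: power_diff_1_eq)
  hence "\<zeta> ^ (q ^ Suc e) = 1" by (simp add: power_mult[symmetric] mult.commute)
  moreover have "\<zeta> ^ (q ^ e) \<noteq> 1" using sum0 q by auto
  ultimately show ?thesis by blast
qed

text \<open>The powers of a root of exact order q^e are distinct: if two agreed, the gcd of q^e with
  the difference of the exponents would be a power q^c with c < e that kills \<zeta>.\<close>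

lemma card_mu_prime_power:
  assumes "prime q"
  shows "card (mu (q ^ e) :: 'a set) = q ^ e"
proof (cases e)
  case 0
  thus ?thesis by (simp add: mu_def)
next
  case (Suc d)
  obtain \<zeta> :: 'a where \<zeta>: "\<zeta> ^ (q ^ e) = 1" "\<zeta> ^ (q ^ d) \<noteq> 1"
    using root_of_unity_prime_power[OF assms, of d] Suc by auto
  have pos: "q ^ e > 0" using assms by (simp add: prime_gt_0_nat)
  have nz: "\<zeta> \<noteq> 0" using \<zeta>(1) pos by (auto simp: power_0_left)
  have inj: "inj_on (\<lambda>i. \<zeta> ^ i) {..<q ^ e}"
  proof (rule linorder_inj_onI')
    fix i j assume ij: "i \<in> {..<q ^ e}" "j \<in> {..<q ^ e}" "i < j"
    show "\<zeta> ^ i \<noteq> \<zeta> ^ j"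
    proof
      assume "\<zeta> ^ i = \<zeta> ^ j"
      moreover have "\<zeta> ^ i * \<zeta> ^ (j - i) = \<zeta> ^ j" using ij by (simp flip: power_add)
      ultimately have "\<zeta> ^ i * \<zeta> ^ (j - i) = \<zeta> ^ i * 1" by simp
      hence "\<zeta> ^ (j - i) = 1" using nz by simp
      hence g: "\<zeta> ^ gcd (j - i) (q ^ e) = 1" using \<zeta>(1) by (rule power_gcd_eq_1)
      obtain c where c: "c \<le> e" "gcd (j - i) (q ^ e) = q ^ c"
        using divides_primepow_nat[OF assms, of "gcd (j - i) (q ^ e)" e] by auto
      have "c \<noteq> e"
      proof
        assume "c = e"
        hence "q ^ e dvd j - i" using c by (metis gcd_dvd1)
        thus False using ij by (auto dest: dvd_imp_le)
      qed
      hence "c \<le> d" using c Suc by simp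
      hence "q ^ d = q ^ c * q ^ (d - c)" by (simp flip: power_add)
      hence "\<zeta> ^ (q ^ d) = 1" using g c by (simp add: power_mult)
      thus False using \<zeta>(2) by simp
    qed
  qed
  have "q ^ e = card ((\<lambda>i. \<zeta> ^ i) ` {..<q ^ e})"
    using inj by (simp add: card_image)
  also have "\<dots> \<le> card (mu (q ^ e) :: 'a set)"
  proof (rule card_mono)
    show "finite (mu (q ^ e) :: 'a set)" using pos by (rule finite_mu)
    have "(\<zeta> ^ i) ^ (q ^ e) = 1" for i
      using \<zeta>(1) by (metis mult.commute power_mult power_one)
    thus "(\<lambda>i. \<zeta> ^ i) ` {..<q ^ e} \<subseteq> mu (q ^ e)" by (auto simp: mu_def)
  qed
  finally show ?thesis using card_mu_le[OF pos, where ?'a = 'a] by simp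
qed

lemma card_mu: "N > 0 \<Longrightarrow> card (mu N :: 'a set) = N"
proof (induction N rule: less_induct)
  case (less N)
  show ?case
  proof (cases "N = 1")
    case True
    thus ?thesis by (simp add: mu_def)
  next
    case False
    then obtain q where q: "prime q" "q dvd N" using prime_factor_nat by blast
    obtain k m where km: "\<not> q dvd m" "N = m * q ^ k"
      using prime_power_canonical[OF q(1) less.prems] by blast
    have "k > 0" using km q(2) by (cases k) auto
    have m: "m > 0" "m < N"
      using less.prems km \<open>k > 0\<close> one_less_power[OF prime_gt_1_nat[OF q(1)] \<open>k > 0\<close>] by auto
    have "coprime m (q ^ k)"
      using km(1) q(1) by (metis coprime_commute coprime_power_right_iff prime_imp_coprime)
    from card_mu_mult_ge[OF this, where ?'a = 'a] have "N \<le> card (mu N :: 'a set)"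
      using m less.IH[of m] card_mu_prime_power[OF q(1), of k] q(1)
      by (simp add: km(2) prime_gt_0_nat)
    thus ?thesis using card_mu_le[OF less.prems, where ?'a = 'a] by simp
  qed
qed

text \<open>Both sides are values at c of monic polynomials of degree N with the same N zeros. The
  factorisation later locates a root of unity near a given element.\<close>

lemma power_minus_1_eq_prod_mu:
  assumes "N > 0"
  shows "c ^ N - 1 = (\<Prod>\<omega>\<in>mu N. c - \<omega> :: 'a)"
proof -
  let ?Q = "\<Prod>\<omega>\<in>mu N. [:- \<omega>, 1:] :: 'a poly"
  have degQ: "degree ?Q = N"
    by (subst degree_prod_eq_sum_degree) (auto simp: card_mu assms)
  have "lead_coeff ?Q = 1" by (subst lead_coeff_prod) simp
  hence lcQ: "poly.coeff ?Q N = 1" by (simp add: degQ)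
  have "monom 1 N - 1 = ?Q"
  proof (rule poly_eqI_degree_lead_coeff[where A = "mu N" and n = N])
    show "poly.coeff (monom 1 N - 1) N = poly.coeff ?Q N"
      unfolding lcQ using assms by simp
    show "poly (monom 1 N - 1) z = poly ?Q z" if "z \<in> mu N" for z
    proof -
      have "poly ?Q z = 0" using that finite_mu[OF assms, where ?'a = 'a] by (auto simp: poly_prod prod_zero_iff)
      thus ?thesis using that by (simp add: mu_eq_roots)
    qed
  qed (auto simp: degQ degree_monom_minus_1 card_mu assms)
  hence "poly (monom 1 N - 1) c = poly ?Q c" by simp
  thus ?thesis by (simp add: poly_monom poly_prod)
qed

end

lemma finite_argmax:
  fixes h :: "'b \<Rightarrow> real"
  assumes "finite A" "A \<noteq> {}"
  shows "\<exists>i\<in>A. \<forall>j\<in>A. h j \<le> h i"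
proof -
  have "Max (h ` A) \<in> h ` A" using assms by (intro Max_in) auto
  then obtain i where i: "i \<in> A" "Max (h ` A) = h i" by auto
  have "h j \<le> h i" if "j \<in> A" for j
    unfolding i(2)[symmetric] using that assms by (intro Max_ge) auto
  thus ?thesis using i(1) by blast
qed

context padic_field
begin

section \<open>The decomposition of the multiplicative group\<close>

lemma absval_of_int_exists:
  assumes "a \<noteq> 0"
  obtains k :: nat where "absval (of_int a :: 'a) = 1 / real p ^ k"
proof -
  have "nat \<bar>a\<bar> > 0" using assms by simp
  then obtain k where "absval (of_nat (nat \<bar>a\<bar>) :: 'a) = 1 / real p ^ k"
    by (rule absval_of_nat_exists)
  moreover have "absval (of_nat (nat \<bar>a\<bar>) :: 'a) = absval (of_int a :: 'a)"
    by (cases "a \<ge> 0") auto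
  ultimately show thesis using that by metis
qed

text \<open>A sufficiently close rational number has the same absolute value, so passing to the
  closure adds no new values.\<close>

lemma absval_Qp_exists:
  assumes "x \<in> (Qp :: 'a set)" "x \<noteq> 0"
  obtains k :: int where "absval x = real p powi k"
proof -
  obtain q where q: "q \<in> \<rat>" "dist q x < absval x"
    using assms unfolding Qp_def closure_approachable by (metis absval_pos_iff)
  hence eq: "absval q = absval x"
    using absval_eq_if_close[of x q] by (simp add: dist_absval absval_minus_commute)
  obtain a b where ab: "b > 0" "q = of_int a / of_int b" using Rats_cases'[OF q(1)] by metis
  have "a \<noteq> 0" using eq assms ab by auto
  obtain k l where "absval (of_int a :: 'a) = 1 / real p ^ k" "absval (of_int b :: 'a) = 1 / real p ^ l"
    using absval_of_int_exists[of a] absval_of_int_exists[of b] \<open>a \<noteq> 0\<close> ab(1)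
    by (metis less_irrefl)
  hence "absval x = real p ^ l / real p ^ k"
    using eq by (simp add: ab(2) absval_divide)
  also have "\<dots> = real p powi (int l - int k)"
    using p_gt_1 by (simp add: power_int_diff)
  finally show thesis using that by blast
qed

text \<open>The residue field of \<open>Qp\<close> is the prime field. A rational a/b in lowest
  terms close to \<open>s * y\<close> satisfies |a/b| <= 1, which forces b to be prime to p; an
  inverse u of b modulo p then yields the integer \<open>a * u\<close>.\<close>

lemma of_int_approximation_Qp:
  assumes "y \<in> (Qp :: 'a set)" "s \<in> \<rat>" "s \<noteq> 0" "absval (s * y) \<le> 1"
  obtains n :: int where "absval (s * y - of_int n) < 1"
proof -
  obtain q where q: "q \<in> \<rat>" "dist q y < 1 / absval s"
    using assms(1,3) unfolding Qp_def closure_approachable by (metis absval_pos_iff zero_less_divide_1_iff)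
  have close: "absval (s * y - s * q) < 1"
  proof -
    have "absval s * absval (y - q) < 1"
      using q(2) assms(3) by (simp add: dist_absval absval_minus_commute[of q] field_simps)
    thus ?thesis by (simp only: absval_mult[symmetric] right_diff_distrib)
  qed
  have "s * q \<in> \<rat>" using q assms by auto
  then obtain a b :: int where ab: "b > 0" "coprime a b" "s * q = of_int a / of_int b"
    by (rule Rats_cases')
  have le1: "absval (s * q) \<le> 1"
    using absval_diff_le[of "s * y" 1 "s * y - s * q"] close assms(4) by simp
  have cop: "coprime b (int p)"
  proof (rule ccontr)
    assume "\<not> coprime b (int p)"
    hence pb: "int p dvd b" using prime_p by (metis coprime_commute prime_imp_coprime prime_nat_int_transfer)
    hence "coprime a (int p)" using ab(2) by (meson coprime_divisors dvd_refl)
    hence a1: "absval (of_int a :: 'a) = 1" by (rule absval_of_int_coprime)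
    obtain c where c: "b = int p * c" using pb by blast
    have "absval (of_int b :: 'a) \<le> 1 / real p"
      using mult_left_mono[OF absval_of_int_le_1[of c, where ?'a = 'a], of "1 / real p"]
      by (simp add: c absval_mult absval_p)
    also have "\<dots> < 1" using p_gt_1 by simp
    finally have "absval (of_int b :: 'a) < 1" .
    moreover have "absval (of_int b :: 'a) > 0" using ab(1) by simp
    ultimately have "absval (s * q) > 1" by (simp add: ab(3) absval_divide a1)
    thus False using le1 by simp
  qed
  then obtain u v :: int where uv: "u * b + v * int p = 1"
    using bezout_int[of b "int p"] by auto
  have b1: "absval (of_int b :: 'a) = 1" using cop by (rule absval_of_int_coprime)
  have "of_int a / of_int b - of_int (a * u) = (of_int a * of_int v * of_nat p / of_int b :: 'a)"
  proof -
    have "of_int (u * b + v * int p) = (1 :: 'a)" by (simp only: uv of_int_1)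
    hence "of_int v * of_nat p = (1 - of_int u * of_int b :: 'a)" by (simp add: algebra_simps)
    hence "of_int a * of_int v * of_nat p / of_int b = (of_int a * (1 - of_int u * of_int b) / of_int b :: 'a)"
      by (simp add: mult.assoc)
    thus ?thesis using ab(1) by (simp add: field_simps)
  qed
  moreover have "absval (of_int a * of_int v * of_nat p / of_int b :: 'a) < 1"
  proof -
    have "absval (of_int (a * v) :: 'a) * absval (of_nat p :: 'a) \<le> 1 * (1 / real p)"
      by (intro mult_mono absval_of_int_le_1) (simp_all add: absval_p)
    also have "\<dots> < 1" using p_gt_1 by simp
    finally show ?thesis by (simp add: absval_mult absval_divide b1)
  qed
  ultimately have "absval (s * q - of_int (a * u)) < 1" by (simp only: ab(3))
  with close have "absval (s * y - of_int (a * u)) < 1" by (rule absval_diff_trans_less)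
  thus thesis by (rule that)
qed

lemma of_int_mod_p_approximation: "absval (of_int n - of_int (n mod int p) :: 'a) < 1"
proof -
  have "of_int n - of_int (n mod int p) = (of_int (n div int p) * of_nat p :: 'a)"
  proof -
    have "n - n mod int p = n div int p * int p" by (simp add: minus_mod_eq_div_mult)
    hence "of_int (n - n mod int p) = (of_int (n div int p * int p) :: 'a)" by simp
    thus ?thesis by simp
  qed
  moreover have "absval (of_int (n div int p) * of_nat p :: 'a) \<le> 1 * (1 / real p)"
    unfolding absval_mult by (intro mult_mono absval_of_int_le_1) (simp_all add: absval_p)
  moreover have "1 * (1 / real p) < 1" using p_gt_1 by simp
  ultimately show ?thesis by simp
qed

text \<open>Newton polygon argument: in a vanishing sum at least two terms attain the maximal
  absolute value. Comparing them expresses a positive power of |b| by the values of two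
  coefficients, which are integral powers of p.\<close>

lemma absval_Qp_bar_exists:
  assumes "b \<in> (Qp_bar :: 'a set)" "b \<noteq> 0"
  obtains n :: nat and k :: int where "n > 0" "absval b ^ n = real p powi k"
proof -
  obtain f :: "'a poly" where f: "f \<noteq> 0" "\<And>i. poly.coeff f i \<in> Qp" "poly f b = 0"
    using assms(1) unfolding Qp_bar_def algebraic_over_def by blast
  define g where "g = (\<lambda>i. poly.coeff f i * b ^ i)"
  have "\<exists>i\<in>{..degree f}. \<forall>j\<in>{..degree f}. absval (g j) \<le> absval (g i)"
    by (rule finite_argmax) auto
  then obtain i where i: "i \<le> degree f" "\<And>j. j \<le> degree f \<Longrightarrow> absval (g j) \<le> absval (g i)"
    by auto
  have "g (degree f) \<noteq> 0" using f(1) assms(2) by (simp add: g_def)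
  hence gi: "absval (g i) > 0" using i(2)[of "degree f"] by (metis absval_pos_iff less_le_trans order_refl)
  have "\<exists>j. j \<le> degree f \<and> j \<noteq> i \<and> absval (g j) = absval (g i)"
  proof (rule ccontr)
    assume "\<not> ?thesis"
    hence less: "absval (g j) < absval (g i)" if "j \<in> {..degree f} - {i}" for j
      using that i(2) by force
    have "0 = (\<Sum>j\<le>degree f. g j)" using f(3) by (simp add: poly_altdef g_def)
    also have "\<dots> = g i + (\<Sum>j\<in>{..degree f} - {i}. g j)" using i by (intro sum.remove) auto
    finally have "(\<Sum>j\<in>{..degree f} - {i}. g j) = - g i" by (simp add: eq_neg_iff_add_eq_0 add.commute)
    hence "absval (\<Sum>j\<in>{..degree f} - {i}. g j) = absval (g i)" by simp
    moreover have "absval (\<Sum>j\<in>{..degree f} - {i}. g j) < absval (g i)"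
      using less gi by (intro absval_sum_less) auto
    ultimately show False by simp
  qed
  then obtain j where j: "j \<noteq> i" "absval (g j) = absval (g i)" by blast
  \<comment> \<open>Stated for arbitrary i < j, since the two maximal terms may come in either
    order.\<close>
  have *: "\<exists>n k. n > 0 \<and> absval b ^ n = real p powi k" if "i < j" "absval (g j) = absval (g i)" "absval (g i) > 0" for i j
  proof -
    have nz: "poly.coeff f i \<noteq> 0" "poly.coeff f j \<noteq> 0" using that by (auto simp: g_def)
    obtain k l where kl: "absval (poly.coeff f i) = real p powi k" "absval (poly.coeff f j) = real p powi l"
      using absval_Qp_exists[OF f(2) nz(1)] absval_Qp_exists[OF f(2) nz(2)] by metis
    have "absval b ^ j = absval b ^ i * absval b ^ (j - i)"
      using that by (simp flip: power_add)
    hence "real p powi l * absval b ^ (j - i) = real p powi k"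
      using that(2) assms(2) kl by (simp add: g_def absval_mult absval_power)
    hence "absval b ^ (j - i) = real p powi (k - l)"
      using p_gt_1 by (simp add: power_int_diff field_simps)
    thus ?thesis using that by (intro exI[of _ "j - i"] exI[of _ "k - l"]) auto
  qed
  from *[of i j] *[of j i] j gi have "\<exists>n k. n > 0 \<and> absval b ^ n = real p powi k"
    by (metis linorder_neqE_nat)
  thus thesis using that by blast
qed

text \<open>The residue of \<open>b\<close> is nonzero and algebraic over the prime field, hence
  lies in a finite field and has finite order. The argument is carried out with congruences modulo
  the maximal ideal, without forming the residue field.\<close>

lemma residue_root_of_unity:
  assumes b: "b \<in> (Qp_bar :: 'a set)" "absval b = 1"
  obtains n where "n > 0" "absval (b ^ n - 1) < 1"
proof -
  obtain f :: "'a poly" where f: "f \<noteq> 0" "\<And>i. poly.coeff f i \<in> Qp" "poly f b = 0"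
    using b(1) unfolding Qp_bar_def algebraic_over_def by blast
  have "\<exists>i\<in>{..degree f}. \<forall>j\<in>{..degree f}. absval (poly.coeff f j) \<le> absval (poly.coeff f i)"
    by (rule finite_argmax) auto
  then obtain i0 where i0: "i0 \<le> degree f"
      "\<And>j. j \<le> degree f \<Longrightarrow> absval (poly.coeff f j) \<le> absval (poly.coeff f i0)"
    by auto
  have nz0: "poly.coeff f i0 \<noteq> 0"
  proof
    assume "poly.coeff f i0 = 0"
    hence "absval (lead_coeff f) \<le> 0" using i0(2)[of "degree f"] by simp
    thus False using f(1) by (simp add: order_antisym_conv)
  qed
  then obtain k where k: "absval (poly.coeff f i0) = real p powi k"
    using absval_Qp_exists[OF f(2)] by blast
  \<comment> \<open>Scaling by a power of p gives the largest coefficient absolute value 1, so the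
    reduced polynomial does not vanish; \<open>s\<close> is rational, as the integer approximation
    requires.\<close>
  define s :: 'a where "s = of_nat p powi k"
  have s: "s \<in> \<rat>" "s \<noteq> 0" "absval s * real p powi k = 1"
  proof -
    have pnz: "(of_nat p :: 'a) \<noteq> 0" using p_gt_1 by simp
    show "s \<noteq> 0" using pnz by (simp add: s_def)
    show "s \<in> \<rat>" by (auto simp: s_def power_int_def)
    show "absval s * real p powi k = 1"
      using p_gt_1 by (simp add: s_def power_int_def absval_power absval_inverse absval_p power_one_over
          flip: power_mult_distrib)
  qed
  have le1: "absval (s * poly.coeff f j) \<le> 1" for j
  proof (cases "j \<le> degree f")
    case True
    thus ?thesis using mult_left_mono[OF i0(2)[OF True], of "absval s"] s(3) by (simp add: absval_mult k)
  qed (simp add: coeff_eq_0)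
  have "\<exists>n :: int. absval (s * poly.coeff f j - of_int n) < 1" for j
    using of_int_approximation_Qp[OF f(2) s(1,2) le1] by metis
  then obtain c :: "nat \<Rightarrow> int" where c: "\<And>j. absval (s * poly.coeff f j - of_int (c j)) < 1" by metis
  have c0: "absval (of_int (c i0) :: 'a) = 1"
  proof -
    have "absval (s * poly.coeff f i0) = 1" using s(3) by (simp add: absval_mult k)
    thus ?thesis using absval_eq_if_close[of "s * poly.coeff f i0" "of_int (c i0)"] c[of i0] by simp
  qed
  \<comment> \<open>The degree of the reduced polynomial.\<close>
  define d where "d = (GREATEST j. j \<le> degree f \<and> absval (of_int (c j) :: 'a) = 1)"
  have d: "d \<le> degree f" "absval (of_int (c d) :: 'a) = 1"
    using GreatestI_nat[of "\<lambda>j. j \<le> degree f \<and> absval (of_int (c j) :: 'a) = 1" i0 "degree f"] i0(1) c0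
    unfolding d_def by auto
  have above: "absval (of_int (c j) :: 'a) < 1" if "j \<le> degree f" "j > d" for j
  proof -
    have "absval (of_int (c j) :: 'a) \<noteq> 1"
      using Greatest_le_nat[of "\<lambda>j. j \<le> degree f \<and> absval (of_int (c j) :: 'a) = 1" j "degree f"] that
      unfolding d_def by auto
    thus ?thesis using absval_of_int_le_1[of "c j", where ?'a = 'a] by simp
  qed
  have sum_small: "absval (\<Sum>j\<le>d. of_int (c j) * b ^ j) < 1"
  proof -
    have "(\<Sum>j\<le>degree f. s * poly.coeff f j * b ^ j) = s * poly f b"
      by (simp add: poly_altdef sum_distrib_left mult.assoc)
    hence 0: "(\<Sum>j\<le>degree f. s * poly.coeff f j * b ^ j) = 0" using f(3) by simp
    have 1: "absval (\<Sum>j\<le>degree f. (s * poly.coeff f j - of_int (c j)) * b ^ j) < 1"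
      using c b(2) by (intro absval_sum_less) (auto simp: absval_mult absval_power)
    have 2: "absval (\<Sum>j\<in>{..degree f} - {..d}. of_int (c j) * b ^ j) < 1"
      using above b(2) by (intro absval_sum_less) (auto simp: absval_mult absval_power)
    have "(\<Sum>j\<le>degree f. (s * poly.coeff f j - of_int (c j)) * b ^ j) =
        - (\<Sum>j\<le>degree f. of_int (c j) * b ^ j)"
      using 0 by (simp add: left_diff_distrib sum_subtractf)
    also have "(\<Sum>j\<le>degree f. of_int (c j) * b ^ j) =
        (\<Sum>j\<in>{..degree f} - {..d}. of_int (c j) * b ^ j) + (\<Sum>j\<le>d. of_int (c j) * b ^ j)"
      using d(1) by (intro sum.subset_diff) auto
    finally have "(\<Sum>j\<le>d. of_int (c j) * b ^ j) =
        - (\<Sum>j\<le>degree f. (s * poly.coeff f j - of_int (c j)) * b ^ j) -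
        (\<Sum>j\<in>{..degree f} - {..d}. of_int (c j) * b ^ j)"
      unfolding minus_equation_iff[of "_ + _"] by (simp only: minus_minus add_diff_cancel_left')
    moreover have "absval (- (\<Sum>j\<le>degree f. (s * poly.coeff f j - of_int (c j)) * b ^ j) -
        (\<Sum>j\<in>{..degree f} - {..d}. of_int (c j) * b ^ j)) < 1"
      by (rule absval_diff_less) (simp_all only: absval_minus 1 2)
    ultimately show ?thesis by (simp only:)
  qed
  \<comment> \<open>For d = 0 the small sum would be \<open>of_int (c 0)\<close>, which has absolute
    value 1.\<close>
  have "d > 0"
    using sum_small d(2) by (cases "d = 0") auto

  \<comment> \<open>Modulo the maximal ideal, \<open>R\<close> is the span of \<open>1, b, \<dots>, b\<^sup>d\<^sup>-\<^sup>1\<close> over the prime field: it is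
    finite and contains every power of \<open>b\<close>, so two powers of \<open>b\<close> are congruent.\<close>
  define lin where "lin = (\<lambda>e :: nat \<Rightarrow> int. \<Sum>i<d. of_int (e i) * b ^ i)"
  define R where "R = {x. \<exists>e. absval (x - lin e) < 1}"
  have R_add: "x + y \<in> R" if "x \<in> R" "y \<in> R" for x y
  proof -
    obtain e e' where "absval (x - lin e) < 1" "absval (y - lin e') < 1" using \<open>x \<in> R\<close> \<open>y \<in> R\<close> by (auto simp: R_def)
    hence "absval ((x - lin e) + (y - lin e')) < 1" by (rule absval_add_less)
    moreover have "(x - lin e) + (y - lin e') = (x + y) - lin (\<lambda>i. e i + e' i)"
      by (simp add: lin_def sum.distrib algebra_simps)
    ultimately show ?thesis by (auto simp: R_def)
  qed
  have R_int: "of_int n * x \<in> R" if "x \<in> R" for x n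
  proof -
    obtain e where e: "absval (x - lin e) < 1" using \<open>x \<in> R\<close> by (auto simp: R_def)
    have "absval (of_int n * (x - lin e)) \<le> 1 * absval (x - lin e)"
      unfolding absval_mult by (intro mult_right_mono absval_of_int_le_1) simp
    hence "absval (of_int n * (x - lin e)) < 1" using e by simp
    moreover have "of_int n * (x - lin e) = of_int n * x - lin (\<lambda>i. n * e i)"
      by (simp add: lin_def sum_distrib_left right_diff_distrib mult.assoc)
    ultimately show ?thesis by (auto simp: R_def)
  qed
  have R_small: "x \<in> R" if "absval (x - y) < 1" "y \<in> R" for x y
    using that absval_diff_trans_less by (auto simp: R_def) blast
  have R_0: "0 \<in> R" unfolding R_def by (rule CollectI, rule exI[of _ "\<lambda>_. 0"]) (simp add: lin_def)
  have R_sum: "sum h A \<in> R" if "\<And>i. i \<in> A \<Longrightarrow> h i \<in> R" for h and A :: "nat set"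
    using that by (induction A rule: infinite_finite_induct) (auto intro: R_add R_0)
  have R_basis: "b ^ i \<in> R" if "i < d" for i
  proof -
    have "lin (\<lambda>j. if j = i then 1 else 0) = b ^ i"
      unfolding lin_def using that by (subst sum.remove[of _ i]) auto
    thus ?thesis unfolding R_def by (intro CollectI exI[of _ "\<lambda>j. if j = i then 1 else 0"]) simp
  qed
  have R_d: "b ^ d \<in> R"
  proof -
    \<comment> \<open>The leading coefficient of the reduction is invertible modulo p; its inverse
      \<open>u\<close> solves the relation for \<open>b ^ d\<close> in terms of lower
      powers.\<close>
    have "coprime (c d) (int p)"
    proof (rule ccontr)
      assume "\<not> ?thesis"
      hence "int p dvd c d" using prime_p
        by (metis coprime_commute prime_imp_coprime prime_nat_int_transfer)
      hence "absval (of_int (c d) :: 'a) < 1" using of_int_mod_p_approximation[of "c d"] by simp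
      thus False using d(2) by simp
    qed
    then obtain u v :: int where uv: "u * c d + v * int p = 1"
      using bezout_int[of "c d" "int p"] by auto
    hence uv': "of_int u * of_int (c d) + of_int v * of_nat p = (1::'a)"
      by (metis of_int_1 of_int_add of_int_mult of_int_of_nat_eq)
    let ?T = "\<Sum>j<d. of_int (c j) * b ^ j"
    have split: "(\<Sum>j\<le>d. of_int (c j) * b ^ j) = ?T + of_int (c d) * b ^ d"
      by (simp flip: lessThan_Suc_atMost)
    have "absval (of_int u * (\<Sum>j\<le>d. of_int (c j) * b ^ j)) \<le> 1 * absval (\<Sum>j\<le>d. of_int (c j) * b ^ j)"
      unfolding absval_mult by (intro mult_right_mono absval_of_int_le_1) simp
    hence 1: "absval (of_int u * (\<Sum>j\<le>d. of_int (c j) * b ^ j)) < 1" using sum_small by simp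
    have "absval (of_int v * of_nat p * b ^ d) \<le> 1 * (1 / real p)"
      unfolding absval_mult absval_power b(2) power_one mult_1_right absval_p
      by (intro mult_right_mono absval_of_int_le_1) simp
    also have "\<dots> < 1" using p_gt_1 by simp
    finally have 2: "absval (of_int v * of_nat p * b ^ d) < 1" .
    have "b ^ d - of_int (- u) * ?T =
        of_int u * (\<Sum>j\<le>d. of_int (c j) * b ^ j) + of_int v * of_nat p * b ^ d"
    proof -
      have "b ^ d = (of_int u * of_int (c d) + of_int v * of_nat p) * b ^ d" by (simp add: uv')
      thus ?thesis unfolding split by (simp add: algebra_simps)
    qed
    hence "absval (b ^ d - of_int (- u) * ?T) < 1" using absval_add_less[OF 1 2] by simp
    moreover have "of_int (- u) * ?T \<in> R" by (intro R_int R_sum R_basis) auto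
    ultimately show ?thesis by (rule R_small)
  qed
  have R_mult: "b * x \<in> R" if "x \<in> R" for x
  proof -
    obtain e where e: "absval (x - lin e) < 1" using \<open>x \<in> R\<close> by (auto simp: R_def)
    hence "absval (b * (x - lin e)) < 1" using b(2) by (simp add: absval_mult)
    moreover have "b * (x - lin e) = b * x - (\<Sum>i<d. of_int (e i) * b ^ Suc i)"
      by (simp add: lin_def right_diff_distrib sum_distrib_left mult_ac)
    moreover have "b ^ Suc i \<in> R" if "i < d" for i
      using R_basis[of "Suc i"] R_d that by (cases "Suc i = d") auto
    hence "(\<Sum>i<d. of_int (e i) * b ^ Suc i) \<in> R"
      by (intro R_sum R_int) auto
    ultimately show ?thesis using R_small[of "b * x"] by metis
  qed
  have R_pow: "b ^ n \<in> R" for n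
    using R_basis[OF \<open>d > 0\<close>] by (induction n) (auto intro: R_mult)
  \<comment> \<open>Reducing coefficients modulo p leaves finitely many representatives;
    extensionality keeps the set of coefficient functions finite.\<close>
  let ?B = "{..<d} \<rightarrow>\<^sub>E {0..<int p}"
  have "\<exists>e\<in>?B. \<not> finite {n \<in> UNIV. absval (b ^ n - lin e) < 1}"
  proof (rule pigeonhole_infinite_rel)
    show "finite ?B" by (intro finite_PiE) auto
    show "\<forall>n\<in>UNIV. \<exists>e\<in>?B. absval (b ^ n - lin e) < 1"
    proof
      fix n :: nat
      obtain e where e: "absval (b ^ n - lin e) < 1" using R_pow[of n] by (auto simp: R_def)
      define e' where "e' = restrict (\<lambda>i. e i mod int p) {..<d}"
      have "e' \<in> ?B" using p_gt_1 by (auto simp: e'_def)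
      moreover have "absval (lin e - lin e') < 1"
      proof -
        have "lin e - lin e' = (\<Sum>i<d. (of_int (e i) - of_int (e i mod int p)) * b ^ i)"
          unfolding lin_def e'_def by (simp add: left_diff_distrib sum_subtractf)
        also have "absval \<dots> < 1"
          using of_int_mod_p_approximation b(2)
          by (intro absval_sum_less) (auto simp: absval_mult absval_power)
        finally show ?thesis .
      qed
      ultimately show "\<exists>e\<in>?B. absval (b ^ n - lin e) < 1"
        using absval_diff_trans_less[OF e] by blast
    qed
  qed auto
  then obtain e where "infinite {n. absval (b ^ n - lin e) < 1}" by auto
  then obtain k l where kl: "k < l" "absval (b ^ k - lin e) < 1" "absval (b ^ l - lin e) < 1"
    by (metis (mono_tags, lifting) infinite_nat_iff_unbounded mem_Collect_eq)
  \<comment> \<open>Two powers with the same representative differ by a small element; the common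
    factor \<open>b ^ k\<close> has absolute value 1 and can be removed.\<close>
  have "absval ((b ^ l - lin e) - (b ^ k - lin e)) < 1" using kl by (intro absval_diff_less[of "b ^ l - lin e"])
  moreover have "(b ^ l - lin e) - (b ^ k - lin e) = b ^ k * (b ^ (l - k) - 1)"
    using kl(1) by (simp add: right_diff_distrib flip: power_add)
  ultimately have "absval (b ^ (l - k) - 1) < 1" using b(2) by (simp add: absval_mult absval_power)
  with kl(1) show thesis by (intro that) auto
qed

text \<open>Injectivity of Frobenius on the residue field: for z = y - 1 the inner binomial
  coefficients are divisible by p, so z^p is congruent to y^p - 1 and z is small as soon as y^p - 1
  is.\<close>

lemma absval_root_close_to_1:
  fixes y :: 'a
  assumes "absval y \<le> 1" "absval (y ^ (p ^ s) - 1) < 1"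
  shows "absval (y - 1) < 1"
  using assms
proof (induction s arbitrary: y)
  case (Suc s)
  have "absval (y ^ p) \<le> 1" using Suc.prems by (simp add: absval_power power_le_one)
  moreover have "absval ((y ^ p) ^ (p ^ s) - 1) < 1" using Suc.prems by (simp add: power_mult)
  ultimately have yp: "absval (y ^ p - 1) < 1" by (rule Suc.IH)
  define z where "z = y - 1"
  have z: "absval z \<le> 1" using absval_diff_le[of y 1 1] Suc.prems by (simp add: z_def)
  obtain q where q: "p = Suc q" using p_gt_1 by (cases p) auto
  have "y ^ p = (z + 1) ^ p" by (simp add: z_def)
  also have "\<dots> = (\<Sum>i\<le>p. of_nat (p choose i) * z ^ i)" by (subst binomial_ring) simp
  also have "\<dots> = (\<Sum>i<p. of_nat (p choose i) * z ^ i) + z ^ p"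
    by (simp flip: lessThan_Suc_atMost)
  also have "(\<Sum>i<p. of_nat (p choose i) * z ^ i) = 1 + (\<Sum>i<q. of_nat (p choose Suc i) * z ^ Suc i)"
    unfolding q by (subst sum.lessThan_Suc_shift) simp
  finally have eq: "z ^ p = (y ^ p - 1) - (\<Sum>i<q. of_nat (p choose Suc i) * z ^ Suc i)"
    by (simp add: algebra_simps)
  have "absval (\<Sum>i<q. of_nat (p choose Suc i) * z ^ Suc i) < 1"
  proof (rule absval_sum_less)
    fix i assume "i \<in> {..<q}"
    hence "p dvd (p choose Suc i)" using prime_p q by (intro dvd_choose_prime) auto
    then obtain m where m: "p choose Suc i = p * m" by blast
    have "absval (of_nat (p * m) * z ^ Suc i) \<le> 1 / real p * 1 * 1"
      unfolding of_nat_mult absval_mult absval_p absval_power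
      using z by (intro mult_mono power_le_one absval_of_nat_le_1) auto
    also have "\<dots> < 1" using p_gt_1 by simp
    finally show "absval (of_nat (p choose Suc i) * z ^ Suc i) < 1" by (simp add: m)
  qed auto
  with yp have "absval (z ^ p) < 1" unfolding eq by (rule absval_diff_less)
  hence "absval z \<noteq> 1" by (auto simp: absval_power)
  with z show ?case by (simp add: z_def)
qed auto

lemma mu_ur_absval:
  assumes "\<omega> \<in> (mu_ur p :: 'a set)"
  shows "absval \<omega> = 1"
proof -
  obtain n where "n > 0" "\<omega> ^ n = 1" using assms by (auto simp: mu_ur_def)
  hence "absval \<omega> ^ n = 1" by (metis absval_1 absval_power)
  thus ?thesis using \<open>n > 0\<close> absval_nonneg[of \<omega>] by (metis power_eq_1_iff abs_of_nonneg real_norm_def less_irrefl)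
qed

lemma mu_ur_mult: "\<omega> \<in> mu_ur p \<Longrightarrow> \<eta> \<in> mu_ur p \<Longrightarrow> \<omega> * \<eta> \<in> (mu_ur p :: 'a set)"
proof -
  assume "\<omega> \<in> mu_ur p" "\<eta> \<in> mu_ur p"
  then obtain m n where mn: "m > 0" "n > 0" "coprime m p" "coprime n p" "\<omega> ^ m = 1" "\<eta> ^ n = 1"
    by (auto simp: mu_ur_def)
  have "(\<omega> * \<eta>) ^ (m * n) = (\<omega> ^ m) ^ n * (\<eta> ^ n) ^ m"
    by (simp add: power_mult_distrib power_mult[symmetric] mult.commute)
  hence "(\<omega> * \<eta>) ^ (m * n) = 1" using mn by simp
  thus ?thesis using mn unfolding mu_ur_def by (intro CollectI exI[of _ "m * n"]) auto
qed

text \<open>For \<open>\<omega> \<noteq> 1\<close> with \<open>\<omega> ^ n = 1\<close> the sum of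
  the first n powers vanishes; but each power is congruent to 1, so the sum is congruent to n, which
  is a unit.\<close>

lemma mu_ur_inter_U0:
  assumes "\<omega> \<in> (mu_ur p :: 'a set)" "\<omega> \<in> U0"
  shows "\<omega> = 1"
proof (rule ccontr)
  assume ne: "\<omega> \<noteq> 1"
  obtain n where n: "n > 0" "coprime n p" "\<omega> ^ n = 1" using assms by (auto simp: mu_ur_def)
  have \<omega>1: "absval \<omega> = 1" by (rule mu_ur_absval[OF assms(1)])
  have "(\<omega> - 1) * (\<Sum>i<n. \<omega> ^ i) = 0" using n(3) power_diff_1_eq[of \<omega> n] by simp
  hence 0: "(\<Sum>i<n. \<omega> ^ i) = 0" using ne by simp
  have "(\<Sum>i<n. \<omega> ^ i - 1) = - of_nat n" by (simp add: sum_subtractf 0)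
  moreover have "absval (\<Sum>i<n. \<omega> ^ i - 1) < 1"
  proof (rule absval_sum_less)
    fix i
    show "absval (\<omega> ^ i - 1) < 1"
      using absval_power_diff_le[of \<omega> 1 i] assms(2) \<omega>1 by (simp add: U0_def)
  qed auto
  ultimately show False using absval_of_nat_coprime[OF n(2)] by simp
qed

end

context Cp_field
begin

section \<open>Rational powers of p and the three components\<close>

lemma pw_add: "pw (r + s) = pw r * pw s" and pw_one: "pw 1 = of_nat p"
  using p_power by (auto simp: is_p_power_def)

lemma pw_zero: "pw 0 = 1"
proof -
  have "pw 1 * pw 0 = pw 1 * 1" using pw_add[of 1 0] by simp
  moreover have "pw 1 \<noteq> 0" using p_gt_1 by (simp add: pw_one)
  ultimately show ?thesis by (simp only: mult_cancel_left) simp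
qed

lemma pw_nonzero [simp]: "pw r \<noteq> 0"
  using pw_add[of r "- r"] by (auto simp: pw_zero)

lemma pw_minus: "pw (- r) = inverse (pw r)"
proof -
  have "pw r * pw (- r) = 1" using pw_add[of r "- r"] by (simp add: pw_zero)
  thus ?thesis by (rule inverse_unique[symmetric])
qed

lemma pw_of_nat_mult: "pw (of_nat n * r) = pw r ^ n"
  by (induction n) (simp_all add: pw_zero pw_add algebra_simps)

lemma absval_pw_of_int: "absval (pw (of_int k)) = real p powi (- k)"
proof -
  have nat: "absval (pw (of_nat n)) = inverse (real p ^ n)" for n
    using pw_of_nat_mult[of n 1] by (simp add: pw_one absval_power absval_p power_one_over inverse_eq_divide)
  show ?thesis
  proof (cases k rule: int_cases2)
    case (nonneg n)
    thus ?thesis by (simp add: nat power_int_minus)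
  next
    case (nonpos n)
    thus ?thesis by (simp add: pw_minus absval_inverse nat)
  qed
qed

text \<open>Raising to the denominator of r reduces the claim to an integral power of p.\<close>

lemma absval_pw_eq_1:
  assumes "absval (pw r) = 1"
  shows "r = 0"
proof -
  obtain a b where ab: "quotient_of r = (a, b)" by fastforce
  have b: "b > 0" and r: "r = of_int a / of_int b"
    using ab quotient_of_denom_pos quotient_of_div by blast+
  have "of_nat (nat b) * r = of_int a" using b by (simp add: r)
  hence "real p powi (- a) = 1"
    using pw_of_nat_mult[of "nat b" r] assms absval_pw_of_int[of a] by (simp add: absval_power)
  hence "real p powi (- a) = real p powi 0" by simp
  hence "a = 0" using p_gt_1 power_int_strict_increasing[of "- a" 0 "real p"]
      power_int_strict_increasing[of 0 "- a" "real p"] by (cases a "0 :: int" rule: linorder_cases) auto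
  thus ?thesis by (simp add: r)
qed

text \<open>Density provides an algebraic \<open>b\<close> with the same absolute value, one of
  whose positive powers has the absolute value of an integral power of p; nonnegative real n-th
  roots are unique.\<close>

lemma absval_pw_surj:
  fixes a :: 'a
  assumes "a \<noteq> 0"
  obtains r where "absval (pw r) = absval a"
proof -
  obtain b where b: "b \<in> Qp_bar" "dist b a < absval a"
    using dense assms closure_approachable[of a "Qp_bar :: 'a set"] by (metis UNIV_I absval_pos_iff)
  have ab: "absval b = absval a"
    using absval_eq_if_close[of a b] b(2) by (simp add: dist_absval absval_minus_commute)
  hence "b \<noteq> 0" using assms by auto
  then obtain n k where nk: "n > 0" "absval b ^ n = real p powi k"
    using absval_Qp_bar_exists[OF b(1)] by blast
  \<comment> \<open>The exponent is -k/n rather than k/n because |p| = 1/p.\<close>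
  have "of_nat n * (of_int (- k) / of_nat n) = (of_int (- k) :: rat)" using nk by simp
  hence "absval (pw (of_int (- k) / of_nat n)) ^ n = absval a ^ n"
    using pw_of_nat_mult[of n "of_int (- k) / of_nat n"] absval_pw_of_int[of "- k"] nk(2) ab
    by (simp only: absval_power[symmetric]) (simp add: absval_power)
  hence "absval (pw (of_int (- k) / of_nat n)) = absval a"
    by (rule power_eq_imp_eq_base[OF _ absval_nonneg absval_nonneg nk(1)])
  thus thesis by (rule that)
qed

text \<open>This finds a Teichmueller representative without Hensel's lemma. After removal of the
  p-part of n, c^m - 1 is small with m prime to p, and it is the product of the differences c -
  \<omega> over \<open>mu m\<close>; these factors cannot all have absolute value at least
  1.\<close>

lemma mu_ur_approximation:
  fixes c :: 'a
  assumes "absval c = 1"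
  obtains \<omega> where "\<omega> \<in> mu_ur p" "absval (c - \<omega>) < 1"
proof -
  obtain b where b: "b \<in> Qp_bar" "dist b c < 1"
    using dense closure_approachable[of c "Qp_bar :: 'a set"] zero_less_one by (metis UNIV_I)
  have b1: "absval b = 1"
    using absval_eq_if_close[of c b] b(2) assms by (simp add: dist_absval absval_minus_commute)
  obtain n where n: "n > 0" "absval (b ^ n - 1) < 1" using residue_root_of_unity[OF b(1) b1] by blast
  obtain s m where sm: "\<not> p dvd m" "n = m * p ^ s"
    using prime_power_canonical[OF prime_p n(1)] by blast
  hence m: "coprime m p" "m > 0" using prime_p n(1)
    by (auto simp: coprime_commute[of m] intro: prime_imp_coprime)
  have "absval (b ^ m - 1) < 1"
  proof (rule absval_root_close_to_1)
    show "absval (b ^ m) \<le> 1" by (simp add: absval_power b1)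
    show "absval ((b ^ m) ^ p ^ s - 1) < 1" using n(2) unfolding sm(2) power_mult .
  qed
  moreover have "absval (c ^ m - b ^ m) < 1"
    using absval_power_diff_le[of c b m] b(2) b1 assms
    by (simp add: dist_absval absval_minus_commute[of b])
  ultimately have "absval (c ^ m - 1) < 1" by (metis absval_diff_trans_less)
  hence "(\<Prod>\<omega>\<in>mu m. absval (c - \<omega>)) < 1"
    using power_minus_1_eq_prod_mu[OF m(2), of c] by (simp add: absval_prod)
  hence "\<exists>\<omega>\<in>mu m. absval (c - \<omega>) < 1"
    using prod_ge_1[of "mu m" "\<lambda>\<omega>. absval (c - \<omega>)"] by (meson not_le)
  thus thesis using m that by (auto simp: mu_def mu_ur_def)
qed

lemma decomposition:
  fixes a :: 'a
  assumes "a \<noteq> 0"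
  obtains r \<omega> u where "\<omega> \<in> mu_ur p" "u \<in> U0" "a = pw r * \<omega> * u"
proof -
  obtain r where r: "absval (pw r) = absval a" using absval_pw_surj[OF assms] by blast
  hence "absval (a / pw r) = 1" using assms by (simp add: absval_divide)
  then obtain \<omega> where \<omega>: "\<omega> \<in> mu_ur p" "absval (a / pw r - \<omega>) < 1"
    using mu_ur_approximation by blast
  have \<omega>1: "absval \<omega> = 1" by (rule mu_ur_absval[OF \<omega>(1)])
  hence "\<omega> \<noteq> 0" by auto
  hence "a / pw r / \<omega> - 1 = (a / pw r - \<omega>) / \<omega>" by (simp add: diff_divide_distrib)
  hence "a / pw r / \<omega> \<in> U0" using \<omega>(2) \<omega>1 by (simp add: U0_def absval_divide)
  with \<omega>(1) show thesis by (rule that[of _ _ r]) (simp add: \<open>\<omega> \<noteq> 0\<close>)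
qed

lemma U0_absval: "u \<in> U0 \<Longrightarrow> absval (u :: 'a) = 1"
  using absval_eq_if_close[of 1 u] by (simp add: U0_def absval_minus_commute[of 1])

text \<open>Uniqueness for the definite description: absolute values determine the exponent, and
  then the quotient of the two roots of unity equals \<open>v / u\<close>, which lies in both
  \<open>mu_ur p\<close> and \<open>U0\<close>.\<close>

lemma U0_part_eq:
  assumes "\<omega> \<in> mu_ur p" "u \<in> U0"
  shows "U0_part p pw (pw r * \<omega> * u) = u"
  unfolding U0_part_def
proof (rule the_equality)
  show "u \<in> U0 \<and> (\<exists>r'. \<exists>\<omega>'\<in>mu_ur p. pw r * \<omega> * u = pw r' * \<omega>' * u)" using assms by blast
next
  fix v assume "v \<in> U0 \<and> (\<exists>r'. \<exists>\<omega>'\<in>mu_ur p. pw r * \<omega> * u = pw r' * \<omega>' * v)"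
  then obtain r' \<omega>' where v: "v \<in> U0" "\<omega>' \<in> mu_ur p" and eq: "pw r * \<omega> * u = pw r' * \<omega>' * v" by blast
  note av = mu_ur_absval[OF assms(1)] mu_ur_absval[OF v(2)] U0_absval[OF assms(2)] U0_absval[OF v(1)]
  have nz: "\<omega> \<noteq> 0" "\<omega>' \<noteq> 0" "u \<noteq> 0" "v \<noteq> 0" using av by auto
  have "absval (pw r) = absval (pw r')"
    using arg_cong[OF eq, of absval] av by (simp add: absval_mult)
  hence "absval (pw (r - r')) = 1"
    using pw_add[of r "- r'"] by (simp add: pw_minus absval_mult absval_inverse)
  hence "r = r'" using absval_pw_eq_1[of "r - r'"] by simp
  hence eq2: "\<omega> * u = \<omega>' * v" using eq by (simp add: mult.assoc)
  obtain n where n: "n > 0" "coprime n p" "\<omega>' ^ n = 1" using v(2) by (auto simp: mu_ur_def)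
  hence "inverse \<omega>' \<in> mu_ur p" unfolding mu_ur_def by (auto simp: power_inverse)
  hence mem: "\<omega> * inverse \<omega>' \<in> mu_ur p" using assms(1) mu_ur_mult by blast
  have quot: "\<omega> * inverse \<omega>' = v / u" using eq2 nz by (simp add: field_simps)
  have "v / u - 1 = ((v - 1) - (u - 1)) / u" using nz by (simp add: diff_divide_distrib)
  moreover have "absval ((v - 1) - (u - 1)) < 1"
    using v(1) assms(2) unfolding U0_def by (intro absval_diff_less[of "v - 1"]) auto
  ultimately have "v / u \<in> U0" using av by (simp add: U0_def absval_divide)
  hence "v / u = 1" using mu_ur_inter_U0 mem unfolding quot by blast
  thus "v = u" using nz by simp
qed

section \<open>Additivity of the p-adic logarithm\<close>

lemma log_p_eq_plog:
  assumes "\<omega> \<in> mu_ur p" "u \<in> U0"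
  shows "log_p p pw (pw r * \<omega> * u) = plog u"
  unfolding log_p_def plog_def U0_part_eq[OF assms] ..

text \<open>The two extra factors merge with the corresponding components of \<open>a\<close>. This
  form of additivity fits the factorisation of the quadratic polynomial.\<close>

lemma log_p_mult:
  fixes a :: 'a
  assumes "a \<noteq> 0" "\<zeta> \<in> mu_ur p" "v \<in> U0"
  shows "log_p p pw (a * \<zeta> * v) = log_p p pw a + plog v"
proof -
  obtain r \<omega> u where d: "\<omega> \<in> mu_ur p" "u \<in> U0" "a = pw r * \<omega> * u"
    using decomposition[OF assms(1)] by blast
  have "a * \<zeta> * v = pw r * (\<omega> * \<zeta>) * (u * v)" by (simp add: d(3) mult_ac)
  hence "log_p p pw (a * \<zeta> * v) = plog (u * v)"
    using log_p_eq_plog[OF mu_ur_mult[OF d(1) assms(2)] U0_mult[OF d(2) assms(3)], of r]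
    by (simp only:)
  thus ?thesis using log_p_eq_plog[OF d(1,2), of r] by (simp add: d(3) plog_mult[OF d(2) assms(3)])
qed

text \<open>-1 is a principal unit for p = 2 and a root of unity of order prime to p otherwise; the
  logarithm kills it in both cases.\<close>

lemma log_p_minus:
  fixes a :: 'a
  assumes "a \<noteq> 0"
  shows "log_p p pw (- a) = log_p p pw a"
proof (cases "p = 2")
  case True
  have "absval (- 1 - 1 :: 'a) = absval (of_nat 2 :: 'a)"
  proof -
    have "- 1 - 1 = (- of_nat 2 :: 'a)" by simp
    thus ?thesis by (simp only: absval_minus)
  qed
  hence mem: "(- 1 :: 'a) \<in> U0" using absval_p True by (simp add: U0_def)
  have "1 \<in> (mu_ur p :: 'a set)" by (auto simp: mu_ur_def intro: exI[of _ 1])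
  from log_p_mult[OF assms this mem] show ?thesis by (simp add: plog_minus_1[OF mem])
next
  case False
  hence "coprime 2 p" using prime_p primes_coprime two_is_prime_nat by blast
  hence "(- 1 :: 'a) \<in> mu_ur p" unfolding mu_ur_def by (intro CollectI exI[of _ 2]) auto
  moreover have "(1 :: 'a) \<in> U0" by (simp add: U0_def)
  ultimately show ?thesis using log_p_mult[OF assms, of "- 1" 1] by simp
qed

end

section \<open>Truncated multiple harmonic sums\<close>

text \<open>The truncated sum over a < m_1 < ... < m_r < n. The lower bound is a parameter because
  the recursion of \<open>harmonic_word\<close> removes the first letter, which belongs to the
  smallest summation index.\<close>

fun mhs :: "nat \<Rightarrow> nat \<Rightarrow> index \<Rightarrow> 'a::nonarch_complete_field" where
  "mhs n a [] = 1"
| "mhs n a (k # v) = (\<Sum>m\<in>{a<..<n}. 1 / of_nat m ^ k * mhs n m v)"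

definition mhs_lin :: "nat \<Rightarrow> nat \<Rightarrow> H1 \<Rightarrow> 'a::nonarch_complete_field" where
  "mhs_lin n a w = (\<Sum>u\<in>Poly_Mapping.keys w. of_rat (Poly_Mapping.lookup w u) * mhs n a u)"

lemma mhs_lin_superset:
  assumes "finite A" "Poly_Mapping.keys w \<subseteq> A"
  shows "mhs_lin n a w = (\<Sum>u\<in>A. of_rat (Poly_Mapping.lookup w u) * mhs n a u)"
  unfolding mhs_lin_def using assms
  by (intro sum.mono_neutral_left) (auto simp: in_keys_iff)

lemma mhs_lin_add: "mhs_lin n a (v + w) = mhs_lin n a v + mhs_lin n a w"
proof -
  let ?A = "Poly_Mapping.keys v \<union> Poly_Mapping.keys w"
  have "mhs_lin n a (v + w) = (\<Sum>u\<in>?A. of_rat (Poly_Mapping.lookup (v + w) u) * mhs n a u)"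
    by (intro mhs_lin_superset keys_add) auto
  also have "\<dots> = mhs_lin n a v + mhs_lin n a w"
    by (simp add: mhs_lin_superset[of ?A] lookup_add of_rat_add distrib_right sum.distrib)
  finally show ?thesis .
qed

lemma mhs_lin_single: "mhs_lin n a (Poly_Mapping.single u c) = of_rat c * mhs n a u"
  by (subst mhs_lin_superset[of "{u}"]) auto

lemma mhs_lin_0: "mhs_lin n a 0 = 0"
  by (simp add: mhs_lin_def)

lemma mhs_lin_sum: "mhs_lin n a (sum g A) = (\<Sum>x\<in>A. mhs_lin n a (g x))"
  by (induction A rule: infinite_finite_induct) (simp_all add: mhs_lin_add mhs_lin_0)

lemma mhs_lin_lmult_e:
  "mhs_lin n a (lmult_e k w) = (\<Sum>m\<in>{a<..<n}. 1 / of_nat m ^ k * mhs_lin n m w)"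
proof -
  have "mhs_lin n a (lmult_e k w) =
      (\<Sum>u\<in>Poly_Mapping.keys w. \<Sum>m\<in>{a<..<n}.
        1 / of_nat m ^ k * (of_rat (Poly_Mapping.lookup w u) * mhs n m u))"
    by (simp add: lmult_e_def mhs_lin_sum mhs_lin_single sum_distrib_left mult_ac)
  also have "\<dots> = (\<Sum>m\<in>{a<..<n}. 1 / of_nat m ^ k * mhs_lin n m w)"
    by (subst sum.swap) (simp add: mhs_lin_def sum_distrib_left)
  finally show ?thesis .
qed

text \<open>Pairs of indices are split according to whether the first is smaller, the second is
  smaller, or both agree; these cases are the three terms in the recursion of the harmonic
  product.\<close>

lemma sum_product_split_order:
  fixes f g :: "nat \<Rightarrow> 'b::comm_ring_1"
  shows "(\<Sum>x\<in>{a<..<n}. f x) * (\<Sum>y\<in>{a<..<n}. g y) =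
    (\<Sum>m\<in>{a<..<n}. f m * (\<Sum>y\<in>{m<..<n}. g y)) + (\<Sum>m\<in>{a<..<n}. g m * (\<Sum>x\<in>{m<..<n}. f x)) +
    (\<Sum>m\<in>{a<..<n}. f m * g m)"
proof -
  have split: "sum g {a<..<n} = sum g {a<..<m} + g m + sum g {m<..<n}" if "m \<in> {a<..<n}" for m
  proof -
    have "{a<..<n} = insert m ({a<..<m} \<union> {m<..<n})" using that by auto
    hence "sum g {a<..<n} = g m + sum g ({a<..<m} \<union> {m<..<n})" by simp
    also have "sum g ({a<..<m} \<union> {m<..<n}) = sum g {a<..<m} + sum g {m<..<n}"
      by (intro sum.union_disjoint) auto
    finally show ?thesis by (simp add: add_ac)
  qed
  have "(\<Sum>x\<in>{a<..<n}. f x) * (\<Sum>y\<in>{a<..<n}. g y) = (\<Sum>x\<in>{a<..<n}. f x * sum g {a<..<n})"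
    by (rule sum_distrib_right)
  also have "\<dots> = (\<Sum>x\<in>{a<..<n}. f x * (sum g {a<..<x} + g x + sum g {x<..<n}))"
    using split by (intro sum.cong) auto
  also have "\<dots> = (\<Sum>x\<in>{a<..<n}. f x * sum g {a<..<x}) + (\<Sum>x\<in>{a<..<n}. f x * g x) +
      (\<Sum>x\<in>{a<..<n}. f x * sum g {x<..<n})"
    by (simp add: distrib_left sum.distrib)
  also have "(\<Sum>x\<in>{a<..<n}. f x * sum g {a<..<x}) = (\<Sum>m\<in>{a<..<n}. g m * (\<Sum>x\<in>{m<..<n}. f x))"
  proof -
    have "(\<Sum>x\<in>{a<..<n}. f x * sum g {a<..<x}) =
        (\<Sum>x\<in>{a<..<n}. \<Sum>y | y \<in> {a<..<n} \<and> y < x. f x * g y)"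
      unfolding sum_distrib_left by (intro sum.cong refl) auto
    also have "\<dots> = (\<Sum>y\<in>{a<..<n}. \<Sum>x | x \<in> {a<..<n} \<and> y < x. f x * g y)"
      by (rule sum.swap_restrict) auto
    also have "\<dots> = (\<Sum>y\<in>{a<..<n}. g y * (\<Sum>x\<in>{y<..<n}. f x))"
      unfolding sum_distrib_left by (intro sum.cong refl) (auto simp: mult.commute)
    finally show ?thesis .
  qed
  finally show ?thesis by (simp add: add_ac)
qed

text \<open>The lower bound varies in the induction: after the smallest index m is split off, the
  remaining sums run above m.\<close>

lemma mhs_mult:
  "mhs n a v * mhs n a w = (mhs_lin n a (harmonic_word v w) :: 'a::nonarch_complete_field)"
proof (induction v w arbitrary: a rule: harmonic_word.induct)
  case (3 k v l w)
  let ?e = "\<lambda>k m. 1 / of_nat m ^ k :: 'a"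
  have "mhs n a (k # v) * mhs n a (l # w) =
      (\<Sum>m\<in>{a<..<n}. ?e k m * mhs n m v * mhs n m (l # w)) +
      (\<Sum>m\<in>{a<..<n}. ?e l m * mhs n m w * mhs n m (k # v)) +
      (\<Sum>m\<in>{a<..<n}. (?e k m * mhs n m v) * (?e l m * mhs n m w))"
    unfolding mhs.simps by (rule sum_product_split_order)
  also have "(\<Sum>m\<in>{a<..<n}. ?e k m * mhs n m v * mhs n m (l # w)) =
      mhs_lin n a (lmult_e k (harmonic_word v (l # w)))"
    unfolding mhs_lin_lmult_e 3(1)[symmetric] by (simp only: mult.assoc)
  also have "(\<Sum>m\<in>{a<..<n}. ?e l m * mhs n m w * mhs n m (k # v)) =
      mhs_lin n a (lmult_e l (harmonic_word (k # v) w))"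
    unfolding mhs_lin_lmult_e 3(2)[symmetric] by (simp only: mult_ac)
  also have "(\<Sum>m\<in>{a<..<n}. (?e k m * mhs n m v) * (?e l m * mhs n m w)) =
      mhs_lin n a (lmult_e (k + l) (harmonic_word v w))"
    unfolding mhs_lin_lmult_e 3(3)[symmetric] by (simp add: power_add mult_ac)
  finally show ?case by (simp only: harmonic_word.simps mhs_lin_add)
qed (simp_all add: word_def mhs_lin_single)

text \<open>Splits off the largest index, whereas the definition splits off the smallest; the
  coefficient recursion of the logarithm powers needs this form.\<close>

lemma mhs_snoc:
  "mhs n a (u @ [k]) = (\<Sum>m\<in>{a<..<n}. 1 / of_nat m ^ k * mhs m a u :: 'a::nonarch_complete_field)"
proof (induction u arbitrary: a)
  case (Cons l u)
  let ?e = "\<lambda>k m. 1 / of_nat m ^ k :: 'a"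
  have "mhs n a ((l # u) @ [k]) =
      (\<Sum>x\<in>{a<..<n}. \<Sum>m\<in>{x<..<n}. ?e l x * (?e k m * mhs m x u))"
    by (simp add: Cons.IH sum_distrib_left)
  also have "\<dots> = (\<Sum>x\<in>{a<..<n}. \<Sum>m | m \<in> {a<..<n} \<and> x < m. ?e l x * (?e k m * mhs m x u))"
    by (intro sum.cong refl) auto
  also have "\<dots> = (\<Sum>m\<in>{a<..<n}. \<Sum>x | x \<in> {a<..<n} \<and> x < m. ?e l x * (?e k m * mhs m x u))"
    by (rule sum.swap_restrict) auto
  also have "\<dots> = (\<Sum>m\<in>{a<..<n}. \<Sum>x\<in>{a<..<m}. ?e l x * (?e k m * mhs m x u))"
    by (intro sum.cong refl) auto
  also have "\<dots> = (\<Sum>m\<in>{a<..<n}. ?e k m * mhs m a (l # u))"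
    by (simp add: sum_distrib_left mult_ac)
  finally show ?case .
qed simp

definition sorted_lists :: "nat \<Rightarrow> nat \<Rightarrow> nat \<Rightarrow> nat list set" where
  "sorted_lists n a l = {ms. length ms = l \<and> sorted_wrt (<) ms \<and> set ms \<subseteq> {a<..<n}}"

lemma finite_sorted_lists: "finite (sorted_lists n a l)"
  by (rule finite_subset[OF _ finite_lists_length_eq[of "{a<..<n}" l]])
     (auto simp: sorted_lists_def)

lemma sorted_lists_Suc:
  "sorted_lists n a (Suc l) = (\<Union>m\<in>{a<..<n}. (#) m ` sorted_lists n m l)"
proof (intro equalityI subsetI)
  fix ms assume "ms \<in> sorted_lists n a (Suc l)"
  moreover from this obtain m ms' where "ms = m # ms'"
    by (cases ms) (auto simp: sorted_lists_def)
  ultimately have "m \<in> {a<..<n}" "ms' \<in> sorted_lists n m l" "ms = m # ms'"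
    by (auto simp: sorted_lists_def)
  thus "ms \<in> (\<Union>m\<in>{a<..<n}. (#) m ` sorted_lists n m l)" by blast
qed (auto simp: sorted_lists_def subset_iff)

text \<open>Links the recursion to the increasing lists over which \<open>Li\<close> is
  summed.\<close>

lemma mhs_eq_sum_sorted_lists:
  "mhs n a ks = (\<Sum>ms\<in>sorted_lists n a (length ks).
     \<Prod>i<length ks. 1 / of_nat (ms ! i) ^ (ks ! i) :: 'a::nonarch_complete_field)"
proof (induction ks arbitrary: a)
  case Nil
  have "sorted_lists n a 0 = {[]}" by (auto simp: sorted_lists_def)
  thus ?case by simp
next
  case (Cons k ks)
  let ?t = "\<lambda>ks ms. \<Prod>i<length ks. 1 / of_nat (ms ! i) ^ (ks ! i) :: 'a"
  have "(\<Sum>ms\<in>sorted_lists n a (length (k # ks)). ?t (k # ks) ms) =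
      (\<Sum>m\<in>{a<..<n}. \<Sum>ms\<in>(#) m ` sorted_lists n m (length ks). ?t (k # ks) ms)"
    unfolding list.size add_Suc_right add_0_right sorted_lists_Suc
    by (rule sum.UNION_disjoint) (auto simp: finite_sorted_lists)
  also have "\<dots> = (\<Sum>m\<in>{a<..<n}. \<Sum>ms\<in>sorted_lists n m (length ks). ?t (k # ks) (m # ms))"
    by (rule sum.cong[OF refl]) (simp add: sum.reindex)
  also have "\<dots> = (\<Sum>m\<in>{a<..<n}. 1 / of_nat m ^ k * mhs n m ks)"
    unfolding Cons.IH sum_distrib_left by (simp add: prod.lessThan_Suc_shift del: prod.lessThan_Suc)
  finally show ?case by simp
qed

context padic_field
begin

text \<open>By the ultrametric inequality only the largest summand counts, and each factor 1/m^k
  with m < n costs at most n^k.\<close>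

lemma absval_mhs_le: "absval (mhs n a u :: 'a) \<le> real n ^ sum_list u"
proof (induction u arbitrary: a)
  case (Cons k u)
  show ?case unfolding mhs.simps
  proof (rule absval_sum_le)
    fix m assume m: "m \<in> {a<..<n}"
    have "absval (1 / of_nat m ^ k :: 'a) = absval (1 / of_nat m :: 'a) ^ k"
      by (simp add: absval_power[symmetric] power_one_over)
    also have "\<dots> \<le> real n ^ k"
      using m by (intro power_mono order_trans[OF absval_inverse_of_nat_le]) auto
    finally show "absval (1 / of_nat m ^ k * mhs n m u :: 'a) \<le> real n ^ sum_list (k # u)"
      unfolding absval_mult sum_list.Cons power_add by (intro mult_mono Cons.IH) auto
  qed simp
qed simp

section \<open>Powers of the logarithm\<close>

text \<open>The coefficients of $(-\log(1-X))^i / i!$.\<close>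

definition log_power_coeff :: "nat \<Rightarrow> nat \<Rightarrow> 'a" where
  "log_power_coeff i n =
     (if i = 0 then (if n = 0 then 1 else 0) else 1 / of_nat n * mhs n 0 (replicate (i - 1) 1))"

lemma log_power_coeff_0 [simp]: "log_power_coeff 0 n = (if n = 0 then 1 else 0)"
  by (simp add: log_power_coeff_def)

lemma log_power_coeff_Suc:
  "log_power_coeff (Suc i) n = 1 / of_nat n * mhs n 0 (replicate i 1)"
  by (simp add: log_power_coeff_def)

text \<open>With L = -log(1 - X), this compares coefficients in the statement that the derivative of
  L^(i+1)/(i+1)! is L^i/i! times 1/(1 - X).\<close>

lemma log_power_coeff_Suc_Suc:
  "of_nat (Suc n) * log_power_coeff (Suc i) (Suc n) = (\<Sum>m\<le>n. log_power_coeff i m)"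
proof (cases i)
  case 0
  have "(\<Sum>m\<le>n. if m = 0 then 1 else 0) = (1::'a)" by (induction n) auto
  thus ?thesis using 0 by (simp add: log_power_coeff_Suc del: of_nat_Suc)
next
  case (Suc j)
  have "of_nat (Suc n) * log_power_coeff (Suc i) (Suc n) = (mhs (Suc n) 0 (replicate j 1 @ [1]) :: 'a)"
    unfolding log_power_coeff_Suc Suc by (simp add: replicate_append_same del: of_nat_Suc)
  also have "\<dots> = (\<Sum>m\<in>{0<..<Suc n}. log_power_coeff i m)"
    unfolding mhs_snoc Suc by (simp add: log_power_coeff_Suc)
  \<comment> \<open>The term m = 0 may be added because \<open>1 / 0 = 0\<close>.\<close>
  also have "\<dots> = (\<Sum>m\<le>n. log_power_coeff i m)"
    by (rule sum.mono_neutral_left) (auto simp: Suc log_power_coeff_Suc)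
  finally show ?thesis .
qed

lemma absval_log_power_coeff_le: "absval (log_power_coeff i n) \<le> real n ^ i"
proof (cases i)
  case 0
  thus ?thesis by simp
next
  case (Suc j)
  have "absval (1 / of_nat n :: 'a) * absval (mhs n 0 (replicate j 1) :: 'a) \<le> real n * real n ^ j"
    using absval_mhs_le[of n 0 "replicate j 1"]
    by (intro mult_mono absval_inverse_of_nat_le) (simp_all add: sum_list_replicate)
  thus ?thesis by (simp only: Suc log_power_coeff_Suc absval_mult power_Suc)
qed

text \<open>Both sides have the same derivative and the same constant term. Here \<open>L\<close> is
  -log(1 - X), whose coefficient at 0 is correctly \<open>1 / 0 = 0\<close>, and \<open>G\<close> is
  1/(1 - X).\<close>

lemma fps_log_power:
  "Abs_fps (\<lambda>n. 1 / of_nat n :: 'a) ^ i = fps_const (fact i) * Abs_fps (log_power_coeff i)"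
proof (induction i)
  case 0
  show ?case by (simp add: fps_eq_iff)
next
  case (Suc i)
  define L where "L = Abs_fps (\<lambda>n. 1 / of_nat n :: 'a)"
  define C where "C = (\<lambda>i. Abs_fps (log_power_coeff i))"
  define G where "G = Abs_fps (\<lambda>_. 1 :: 'a)"
  have dL: "fps_deriv L = G"
    by (simp add: L_def G_def fps_eq_iff del: of_nat_Suc)
  have dC: "fps_deriv (C (Suc i)) = C i * G"
  proof (rule fps_ext)
    fix n
    show "fps_nth (fps_deriv (C (Suc i))) n = fps_nth (C i * G) n"
      using log_power_coeff_Suc_Suc[of n i]
      by (simp add: C_def G_def fps_mult_nth atMost_atLeast0 del: of_nat_Suc)
  qed
  have IH: "L ^ i = fps_const (fact i) * C i" using Suc by (simp add: L_def C_def)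
  have "fps_deriv (L ^ Suc i) = of_nat (Suc i) * (L ^ i * G)"
    by (subst fps_deriv_power') (simp add: dL mult_ac del: of_nat_Suc power_Suc)
  also have "\<dots> = fps_const (of_nat (Suc i) * fact i) * fps_deriv (C (Suc i))"
    unfolding IH dC by (simp add: fps_of_nat[symmetric] mult_ac fps_const_mult[symmetric] del: of_nat_Suc fps_const_mult)
  also have "\<dots> = fps_deriv (fps_const (fact (Suc i)) * C (Suc i))"
    by (simp add: fps_deriv_mult)
  finally have "fps_deriv (L ^ Suc i) = fps_deriv (fps_const (fact (Suc i)) * C (Suc i))" .
  moreover have "fps_nth (L ^ Suc i) 0 = fps_nth (fps_const (fact (Suc i)) * C (Suc i)) 0"
    by (simp add: L_def C_def log_power_coeff_Suc)
  ultimately have "L ^ Suc i = fps_const (fact (Suc i)) * C (Suc i)"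
    unfolding fps_deriv_eq_iff by simp
  thus ?case by (simp add: L_def C_def)
qed

lemma log_power_coeff_tendsto_0:
  assumes "absval x < 1"
  shows "(\<lambda>n. log_power_coeff i n * x ^ n) \<longlonglongrightarrow> 0"
  using assms absval_log_power_coeff_le by (rule tendsto_poly_geometric)

text \<open>The formal identity \<open>fps_log_power\<close> becomes an identity of values through
  repeated Cauchy products.\<close>

lemma plog_power_sums:
  assumes x: "absval x < 1"
  shows "(\<lambda>n. fact i * log_power_coeff i n * x ^ n) sums ((- plog (1 - x)) ^ i)"
proof (induction i)
  case 0
  have "(\<lambda>n. fact 0 * log_power_coeff 0 n * x ^ n) sums (\<Sum>n\<in>{0}. fact 0 * log_power_coeff 0 n * x ^ n)"
    by (rule sums_finite) auto
  thus ?case by simp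
next
  case (Suc i)
  let ?c = "\<lambda>i n. fact i * log_power_coeff i n :: 'a"
  have "(\<lambda>n. fact i * (log_power_coeff i n * x ^ n)) \<longlonglongrightarrow> fact i * 0"
    by (intro tendsto_mult tendsto_const log_power_coeff_tendsto_0 x)
  hence lim: "(\<lambda>n. ?c i n * x ^ n) \<longlonglongrightarrow> 0" by (simp add: mult.assoc)
  have "(\<lambda>n. \<Sum>k\<le>n. (1 / of_nat k * x ^ k) * (?c i (n - k) * x ^ (n - k))) sums
      ((- plog (1 - x)) * (- plog (1 - x)) ^ i)"
    by (intro sums_Cauchy_product_nonarch log_coeff_tendsto_0 plog_1_minus_sums x lim Suc)
  also have "(\<lambda>n. \<Sum>k\<le>n. (1 / of_nat k * x ^ k) * (?c i (n - k) * x ^ (n - k))) =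
      (\<lambda>n. ?c (Suc i) n * x ^ n)"
  proof
    fix n
    have "(\<Sum>k\<le>n. 1 / of_nat k * ?c i (n - k)) =
        fps_nth (Abs_fps (\<lambda>n. 1 / of_nat n) ^ Suc i) n"
      unfolding power_Suc fps_log_power fps_mult_nth[of "Abs_fps _"] by (simp add: atMost_atLeast0)
    also have "\<dots> = ?c (Suc i) n" unfolding fps_log_power by simp
    finally have eq: "(\<Sum>k\<le>n. 1 / of_nat k * ?c i (n - k)) = ?c (Suc i) n" .
    have "(1 / of_nat k * x ^ k) * (?c i (n - k) * x ^ (n - k)) = 1 / of_nat k * ?c i (n - k) * x ^ n"
      if "k \<le> n" for k
    proof -
      have "x ^ n = x ^ k * x ^ (n - k)" using that by (simp flip: power_add)
      thus ?thesis by (simp add: mult_ac)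
    qed
    hence "(\<Sum>k\<le>n. (1 / of_nat k * x ^ k) * (?c i (n - k) * x ^ (n - k))) =
        (\<Sum>k\<le>n. 1 / of_nat k * ?c i (n - k) * x ^ n)"
      by (intro sum.cong) auto
    also have "\<dots> = ?c (Suc i) n * x ^ n" by (simp only: sum_distrib_right[symmetric] eq)
    finally show "(\<Sum>k\<le>n. (1 / of_nat k * x ^ k) * (?c i (n - k) * x ^ (n - k))) =
        ?c (Suc i) n * x ^ n" .
  qed
  finally show ?case by simp
qed

section \<open>Multiple polylogarithms\<close>

text \<open>The index lists of \<open>Li\<close> are grouped by their last entry n, which carries
  t^n and, through the appended 2, the factor 1/n^2; the other entries contribute a truncated
  harmonic sum below n.\<close>

lemma Li_snoc_sums:
  fixes t :: 'a
  assumes t: "absval t < 1"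
  shows "(\<lambda>n. 1 / of_nat n ^ 2 * mhs n 0 u * t ^ n) sums Li (u @ [2]) t"
proof -
  let ?ks = "u @ [2 :: nat]"
  let ?I = "{ms :: nat list. length ms = length ?ks \<and> sorted_wrt (<) ms \<and> (\<forall>m\<in>set ms. 0 < m)}"
  define F where "F = (\<lambda>ms. t ^ last ms / (\<Prod>i<length ?ks. of_nat (ms ! i) ^ (?ks ! i)))"
  define S where "S = (\<lambda>M. (\<Union>n\<in>{0<..<M}. (\<lambda>ms. ms @ [n]) ` sorted_lists n 0 (length u)))"
  \<comment> \<open>The weight of the index: if all entries of a list are at most n, the reciprocal
    of its denominator has absolute value at most n^D.\<close>
  define D where "D = sum_list u + 2"
  define g where "g = (\<lambda>n. 1 / of_nat n ^ 2 * mhs n 0 u * t ^ n)"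
  have prod_snoc: "(\<Prod>i<length ?ks. of_nat ((ms @ [n]) ! i) ^ (?ks ! i)) =
      (\<Prod>i<length u. of_nat (ms ! i) ^ (u ! i)) * (of_nat n ^ 2 :: 'a)"
    if "length ms = length u" for ms and n :: nat
    using that by (simp add: nth_append)
  have g0: "g 0 = 0" by (simp add: g_def)
  have g_bound: "absval (1 / of_nat n ^ 2 * mhs n 0 u :: 'a) \<le> real n ^ D" for n
  proof -
    have "absval (1 / of_nat n ^ 2 :: 'a) = absval (1 / of_nat n :: 'a) ^ 2"
      by (simp add: absval_power[symmetric] power_one_over)
    also have "\<dots> \<le> real n ^ 2" by (intro power_mono absval_inverse_of_nat_le) simp
    finally have "absval (1 / of_nat n ^ 2 :: 'a) * absval (mhs n 0 u :: 'a) \<le> real n ^ 2 * real n ^ sum_list u"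
      by (intro mult_mono absval_mhs_le) auto
    thus ?thesis unfolding absval_mult D_def power_add by (simp only: mult.commute)
  qed
  have "g \<longlonglongrightarrow> 0" unfolding g_def using t g_bound by (rule tendsto_poly_geometric)
  hence "summable g" by (rule summable_nonarch)
  then obtain l where l: "g sums l" by (auto simp: summable_def)
  have F_snoc: "F (ms @ [n]) = t ^ n / of_nat n ^ 2 * (\<Prod>i<length u. 1 / of_nat (ms ! i) ^ (u ! i))"
    if "length ms = length u" for ms n
    unfolding F_def prod_snoc[OF that] by (simp add: prod_dividef)
  have sum_S: "sum F (S M) = sum g {..<M}" for M
  proof -
    have "sum F (S M) = (\<Sum>n\<in>{0<..<M}. sum F ((\<lambda>ms. ms @ [n]) ` sorted_lists n 0 (length u)))"
      unfolding S_def by (rule sum.UNION_disjoint) (auto simp: finite_sorted_lists)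
    also have "\<dots> = (\<Sum>n\<in>{0<..<M}. \<Sum>ms\<in>sorted_lists n 0 (length u). F (ms @ [n]))"
      by (rule sum.cong[OF refl]) (simp add: sum.reindex inj_on_def)
    also have "\<dots> = (\<Sum>n\<in>{0<..<M}. g n)"
    proof (intro sum.cong refl)
      fix n
      have "(\<Sum>ms\<in>sorted_lists n 0 (length u). F (ms @ [n])) = (\<Sum>ms\<in>sorted_lists n 0 (length u).
          t ^ n / of_nat n ^ 2 * (\<Prod>i<length u. 1 / of_nat (ms ! i) ^ (u ! i)))"
        by (intro sum.cong refl F_snoc) (simp add: sorted_lists_def)
      also have "\<dots> = t ^ n / of_nat n ^ 2 * mhs n 0 u"
        unfolding mhs_eq_sum_sorted_lists sum_distrib_left ..
      finally show "(\<Sum>ms\<in>sorted_lists n 0 (length u). F (ms @ [n])) = g n"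
        by (simp add: g_def)
    qed
    also have "\<dots> = sum g {..<M}"
      by (rule sum.mono_neutral_left) (auto simp: g0 not_less)
    finally show ?thesis .
  qed
  have mem_I: "\<exists>ms' n. ms = ms' @ [n] \<and> 0 < n \<and> ms' \<in> sorted_lists n 0 (length u)" if "ms \<in> ?I" for ms
  proof -
    have "ms \<noteq> []" using that by auto
    then obtain ms' n where "ms = ms' @ [n]" by (metis append_butlast_last_id)
    thus ?thesis using that by (auto simp: sorted_lists_def sorted_wrt_append)
  qed
  have bound: "absval (F (ms @ [n])) \<le> real n ^ D * absval t ^ n"
    if "0 < n" "ms \<in> sorted_lists n 0 (length u)" for ms n
  proof -
    have len: "length ms = length u" using that by (simp add: sorted_lists_def)
    have inv: "absval (1 / of_nat m ^ k :: 'a) \<le> real n ^ k" if "m \<le> n" for m k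
    proof -
      have "absval (1 / of_nat m ^ k :: 'a) = absval (1 / of_nat m :: 'a) ^ k"
        by (simp add: absval_power[symmetric] power_one_over)
      also have "\<dots> \<le> real n ^ k"
        using that by (intro power_mono order_trans[OF absval_inverse_of_nat_le]) auto
      finally show ?thesis .
    qed
    have "absval (\<Prod>i<length u. 1 / of_nat (ms ! i) ^ (u ! i) :: 'a) \<le> (\<Prod>i<length u. real n ^ (u ! i))"
      unfolding absval_prod
    proof (intro prod_mono conjI absval_nonneg inv)
      fix i assume "i \<in> {..<length u}"
      hence "ms ! i \<in> set ms" using len by auto
      thus "ms ! i \<le> n" using that(2) by (auto simp: sorted_lists_def)
    qed
    also have "\<dots> = real n ^ sum_list u"
      by (simp add: power_sum sum_list_sum_nth atLeast0LessThan)
    finally have 1: "absval (\<Prod>i<length u. 1 / of_nat (ms ! i) ^ (u ! i) :: 'a) \<le> real n ^ sum_list u" .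
    have "absval (1 / of_nat n ^ 2 :: 'a) * absval (\<Prod>i<length u. 1 / of_nat (ms ! i) ^ (u ! i) :: 'a)
        \<le> real n ^ 2 * real n ^ sum_list u"
      by (intro mult_mono inv 1) auto
    hence "absval t ^ n * (absval (1 / of_nat n ^ 2 :: 'a) *
        absval (\<Prod>i<length u. 1 / of_nat (ms ! i) ^ (u ! i) :: 'a)) \<le> absval t ^ n * (real n ^ 2 * real n ^ sum_list u)"
      by (intro mult_left_mono) auto
    moreover have "absval (F (ms @ [n])) = absval t ^ n * (absval (1 / of_nat n ^ 2 :: 'a) *
        absval (\<Prod>i<length u. 1 / of_nat (ms ! i) ^ (u ! i) :: 'a))"
      unfolding F_snoc[OF len] by (simp only: absval_mult absval_divide absval_power absval_1 mult_ac times_divide_eq_right times_divide_eq_left mult_1)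
    ultimately show ?thesis by (simp only: D_def power_add mult_ac)
  qed
  have lim: "(\<lambda>n. real n ^ D * absval t ^ n) \<longlonglongrightarrow> 0"
    using t by (intro power_times_geometric_tendsto_0) auto
  have "(F has_sum l) ?I"
  proof (rule has_sum_exhaustion_nonarch[of S])
    show "finite (S M)" for M by (simp add: S_def finite_sorted_lists)
    show "S M \<subseteq> ?I" for M
      by (auto simp: S_def sorted_lists_def sorted_wrt_append subset_iff)
  next
    fix e :: real assume "0 < e"
    then obtain K where K: "\<And>n. n \<ge> K \<Longrightarrow> real n ^ D * absval t ^ n < e"
      using order_tendstoD(2)[OF lim] by (auto simp: eventually_sequentially)
    have "absval (F ms) < e" if "M \<ge> K" "ms \<in> ?I - S M" for ms M
    proof -
      obtain ms' n where ms: "ms = ms' @ [n]" "0 < n" "ms' \<in> sorted_lists n 0 (length u)"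
        using mem_I \<open>ms \<in> ?I - S M\<close> by blast
      hence "n \<ge> M" using \<open>ms \<in> ?I - S M\<close> by (auto simp: S_def not_less[symmetric])
      thus ?thesis using bound[OF ms(2,3)] K[of n] \<open>M \<ge> K\<close> by (simp add: ms(1))
    qed
    thus "eventually (\<lambda>M. \<forall>ms\<in>?I - S M. absval (F ms) < e) sequentially"
      unfolding eventually_sequentially by blast
  next
    show "(\<lambda>M. sum F (S M)) \<longlonglongrightarrow> l" using l by (simp add: sum_S sums_def)
  qed
  hence "Li ?ks t = l" unfolding Li_def F_def by (rule infsumI)
  thus ?thesis using l by (simp add: g_def)
qed

lemma harmonic_word_word: "word v \<^bold>* word w = harmonic_word v w"
proof -
  have "Poly_Mapping.map (\<lambda>c. c) x = x" for x :: H1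
    by (rule poly_mapping_eqI) (simp add: Poly_Mapping.map.rep_eq when_def)
  thus ?thesis by (simp add: harmonic_def word_def)
qed

text \<open>The factors 1/n of the two coefficients combine to 1/n^2, the contribution of the
  appended 2, and the product of the truncated sums expands by the harmonic product.\<close>

lemma Li_append2_harmonic_sums:
  fixes t :: 'a
  assumes t: "absval t < 1"
  shows "(\<lambda>n. log_power_coeff (Suc i) n * log_power_coeff (Suc j) n * t ^ n) sums
     Li_append2 (word (replicate i 1) \<^bold>* word (replicate j 1)) t"
proof -
  let ?w = "harmonic_word (replicate i 1) (replicate j 1)"
  have "(\<lambda>n. \<Sum>u\<in>Poly_Mapping.keys ?w. of_rat (Poly_Mapping.lookup ?w u) * (1 / of_nat n ^ 2 * mhs n 0 u * t ^ n)) sums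
      Li_append2 ?w t"
    unfolding Li_append2_def by (intro sums_sum sums_mult_const Li_snoc_sums t)
  also have "(\<lambda>n. \<Sum>u\<in>Poly_Mapping.keys ?w. of_rat (Poly_Mapping.lookup ?w u) * (1 / of_nat n ^ 2 * mhs n 0 u * t ^ n)) =
      (\<lambda>n. 1 / of_nat n ^ 2 * mhs_lin n 0 ?w * t ^ n)"
    by (simp add: mhs_lin_def sum_distrib_left sum_distrib_right mult_ac)
  also have "\<dots> = (\<lambda>n. log_power_coeff (Suc i) n * log_power_coeff (Suc j) n * t ^ n)"
    by (simp add: log_power_coeff_Suc mhs_mult[symmetric] power2_eq_square mult_ac)
  finally show ?thesis by (simp add: harmonic_word_word)
qed

end

section \<open>Means over roots of unity\<close>

context Cp_field
begin

text \<open>Both series are truncated at N terms. Exponents then stay below N, so orthogonality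
  involves no wrap-around modulo N and the mean is exactly a partial sum of the series for
  \<open>s\<close>. The truncation error is uniform on the unit circle, and division by the unit N
  preserves it.\<close>

lemma mean_mu_product_tendsto:
  fixes a b :: "nat \<Rightarrow> 'a"
  assumes a: "a \<longlonglongrightarrow> 0" and b: "b \<longlonglongrightarrow> 0"
    and F: "\<And>\<zeta>. absval \<zeta> = 1 \<Longrightarrow> (\<lambda>n. a n * \<zeta> ^ n) sums F \<zeta>"
    and G: "\<And>\<zeta>. absval \<zeta> = 1 \<Longrightarrow> (\<lambda>n. b n * inverse \<zeta> ^ n) sums G \<zeta>"
    and s: "(\<lambda>n. a n * b n) sums s"
  shows "((\<lambda>N. (\<Sum>\<zeta>\<in>mu N. F \<zeta> * G \<zeta>) / of_nat N) \<longlongrightarrow> s)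
           (inf sequentially (principal {N. coprime N p}))"
proof (rule tendstoI)
  fix e :: real assume e: "0 < e"
  obtain K where K: "K > 0" "\<And>n. absval (a n) \<le> K" "\<And>n. absval (b n) \<le> K"
    using tendsto_0_absval_bounded[OF a b] by blast
  \<comment> \<open>An error \<delta> in one factor times the bound \<open>K\<close> for the other
    gives e/2, strictly below e.\<close>
  define \<delta> where "\<delta> = e / 2 / K"
  have \<delta>: "\<delta> > 0" "\<delta> * K = e / 2" using e K(1) by (simp_all add: \<delta>_def)
  have "eventually (\<lambda>n. absval (a n) < \<delta> \<and> absval (b n) < \<delta>) sequentially"
    using a b \<delta>(1) unfolding tendsto_0_absval_iff
    by (intro eventually_conj order_tendstoD(2)) auto
  then obtain M where M: "\<And>n. n \<ge> M \<Longrightarrow> absval (a n) < \<delta> \<and> absval (b n) < \<delta>"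
    by (auto simp: eventually_sequentially)
  have "dist ((\<Sum>\<zeta>\<in>mu N. F \<zeta> * G \<zeta>) / of_nat N) s < e" if N: "N \<ge> M" "N > 0" "coprime N p" for N
  proof -
    define FN where "FN = (\<lambda>\<zeta>. \<Sum>n<N. a n * \<zeta> ^ n)"
    define GN where "GN = (\<lambda>\<zeta>. \<Sum>n<N. b n * inverse \<zeta> ^ n)"
    have N1: "absval (of_nat N :: 'a) = 1" using N(3) by (rule absval_of_nat_coprime)
    have approx: "absval (F \<zeta> * G \<zeta> - FN \<zeta> * GN \<zeta>) \<le> e / 2" if "\<zeta> \<in> mu N" for \<zeta>
    proof -
      have "\<zeta> \<in> mu_ur p" using that N by (auto simp: mu_def mu_ur_def)
      hence \<zeta>: "absval \<zeta> = 1" by (rule mu_ur_absval)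
      have 1: "absval (F \<zeta> - FN \<zeta>) \<le> \<delta>"
        unfolding FN_def
      proof (rule absval_suminf_minus_partial_le[OF F[OF \<zeta>]])
        show "absval (a n * \<zeta> ^ n) \<le> \<delta>" if "N \<le> n" for n
          using M[of n] that N(1) \<zeta> by (simp add: absval_mult absval_power)
      qed
      have 2: "absval (G \<zeta> - GN \<zeta>) \<le> \<delta>"
        unfolding GN_def
      proof (rule absval_suminf_minus_partial_le[OF G[OF \<zeta>]])
        show "absval (b n * inverse \<zeta> ^ n) \<le> \<delta>" if "N \<le> n" for n
          using M[of n] that N(1) \<zeta> by (simp add: absval_mult absval_power absval_inverse)
      qed
      have 3: "absval (G \<zeta>) \<le> K"
        by (rule absval_sums_le[OF G[OF \<zeta>]]) (simp add: K \<zeta> absval_mult absval_power absval_inverse)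
      have 4: "absval (FN \<zeta>) \<le> K"
        unfolding FN_def using K \<zeta> by (intro absval_sum_le) (auto simp: absval_mult absval_power)
      have "F \<zeta> * G \<zeta> - FN \<zeta> * GN \<zeta> = (F \<zeta> - FN \<zeta>) * G \<zeta> + FN \<zeta> * (G \<zeta> - GN \<zeta>)"
        by (simp add: algebra_simps)
      also have "absval \<dots> \<le> e / 2"
      proof (rule absval_add_le)
        show "absval ((F \<zeta> - FN \<zeta>) * G \<zeta>) \<le> e / 2"
          unfolding absval_mult \<delta>(2)[symmetric] using 1 3 \<delta>(1) by (intro mult_mono) auto
        show "absval (FN \<zeta> * (G \<zeta> - GN \<zeta>)) \<le> e / 2"
          unfolding absval_mult \<delta>(2)[symmetric] mult.commute[of \<delta>]
          using 2 4 K(1) by (intro mult_mono) auto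
      qed
      finally show ?thesis .
    qed
    have "(\<Sum>\<zeta>\<in>mu N. FN \<zeta> * GN \<zeta>) =
        (\<Sum>\<zeta>\<in>mu N. \<Sum>m<N. \<Sum>n<N. (a m * b n) * (\<zeta> ^ m * inverse \<zeta> ^ n))"
      unfolding FN_def GN_def sum_product by (simp add: mult_ac)
    also have "\<dots> = (\<Sum>m<N. \<Sum>n<N. \<Sum>\<zeta>\<in>mu N. (a m * b n) * (\<zeta> ^ m * inverse \<zeta> ^ n))"
      by (subst sum.swap) (intro sum.cong refl sum.swap)
    also have "\<dots> = (\<Sum>m<N. \<Sum>n<N. (a m * b n) * (if m = n then of_nat N else 0))"
      unfolding sum_distrib_left[symmetric]
      by (intro sum.cong refl arg_cong2[of _ _ _ _ "(*)"] sum_mu_orthogonality card_mu) (use N in auto)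
    also have "\<dots> = (\<Sum>m<N. a m * b m * of_nat N)"
    proof (rule sum.cong[OF refl])
      fix m assume "m \<in> {..<N}"
      thus "(\<Sum>n<N. (a m * b n) * (if m = n then of_nat N else 0)) = a m * b m * of_nat N"
        by (subst sum.remove[of _ m]) auto
    qed
    also have "\<dots> = (\<Sum>m<N. a m * b m) * of_nat N"
      by (simp add: sum_distrib_right)
    finally have orth: "(\<Sum>\<zeta>\<in>mu N. FN \<zeta> * GN \<zeta>) = (\<Sum>m<N. a m * b m) * of_nat N" .
    have nz: "of_nat N \<noteq> (0::'a)" using N(2) by simp
    have "(\<Sum>\<zeta>\<in>mu N. F \<zeta> * G \<zeta>) / of_nat N - s =
        (\<Sum>\<zeta>\<in>mu N. F \<zeta> * G \<zeta> - FN \<zeta> * GN \<zeta>) / of_nat N - (s - (\<Sum>m<N. a m * b m))"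
      unfolding sum_subtractf orth diff_divide_distrib using nz by simp
    also have "absval \<dots> \<le> e / 2"
    proof (rule absval_diff_le)
      have "absval (\<Sum>\<zeta>\<in>mu N. F \<zeta> * G \<zeta> - FN \<zeta> * GN \<zeta>) \<le> e / 2"
        using approx e by (intro absval_sum_le) auto
      thus "absval ((\<Sum>\<zeta>\<in>mu N. F \<zeta> * G \<zeta> - FN \<zeta> * GN \<zeta>) / of_nat N) \<le> e / 2"
        by (simp only: absval_divide N1 div_by_1)
      show "absval (s - (\<Sum>m<N. a m * b m)) \<le> e / 2"
      proof (rule absval_suminf_minus_partial_le[OF s])
        show "absval (a n * b n) \<le> e / 2" if "N \<le> n" for n
          unfolding absval_mult \<delta>(2)[symmetric] using M[of n] K that N(1) \<delta>(1)
          by (intro mult_mono) auto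
      qed
    qed
    finally show ?thesis using e by (simp add: dist_absval)
  qed
  thus "\<forall>\<^sub>F N in inf sequentially (principal {N. coprime N p}).
      dist ((\<Sum>\<zeta>\<in>mu N. F \<zeta> * G \<zeta>) / of_nat N) s < e"
    unfolding eventually_inf_principal eventually_sequentially
    by (intro exI[of _ "max M 1"]) auto
qed

text \<open>Limits along this filter are unique only if it is nontrivial; the numbers
  \<open>K * p + 1\<close> show that it is.\<close>

lemma coprime_filter_nontrivial: "inf sequentially (principal {N. coprime N p}) \<noteq> bot"
proof
  assume "inf sequentially (principal {N. coprime N p}) = bot"
  hence "eventually (\<lambda>_. False) (inf sequentially (principal {N. coprime N p}))" by simp
  then obtain K where K: "\<And>N. N \<ge> K \<Longrightarrow> \<not> coprime N p"
    by (auto simp: eventually_inf_principal eventually_sequentially)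
  have "gcd p (K * p + 1) = 1" by (simp only: gcd_add_mult gcd_1_nat coprime_1_right)
  hence "coprime (K * p + 1) p" by (simp only: coprime_iff_gcd_eq_1 gcd.commute)
  moreover have "K * p + 1 \<ge> K" using mult_le_mono2[of 1 p K] p_gt_1 by linarith
  ultimately show False using K by blast
qed

end

section \<open>Evaluation of Laurent polynomials\<close>

lemma laurent_eval_superset:
  assumes "finite A" "Poly_Mapping.keys f \<subseteq> A"
  shows "laurent_eval f z = (\<Sum>e\<in>A. Poly_Mapping.lookup f e * (\<Prod>i\<in>UNIV. z i powi Poly_Mapping.lookup e i))"
  unfolding laurent_eval_def using assms by (intro sum.mono_neutral_left) (auto simp: in_keys_iff)

lemma laurent_eval_add: "laurent_eval (f + g) z = laurent_eval f z + laurent_eval g z"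
proof -
  let ?A = "Poly_Mapping.keys f \<union> Poly_Mapping.keys g"
  have "laurent_eval (f + g) z = (\<Sum>e\<in>?A. Poly_Mapping.lookup (f + g) e * (\<Prod>i\<in>UNIV. z i powi Poly_Mapping.lookup e i))"
    by (intro laurent_eval_superset keys_add) auto
  also have "\<dots> = laurent_eval f z + laurent_eval g z"
    by (simp add: laurent_eval_superset[of ?A] lookup_add distrib_right sum.distrib)
  finally show ?thesis .
qed

lemma laurent_eval_single:
  "laurent_eval (Poly_Mapping.single e c) z = c * (\<Prod>i\<in>UNIV. z i powi Poly_Mapping.lookup e i)"
  by (subst laurent_eval_superset[of "{e}"]) auto

text \<open>The product is expanded into monomials, so that additivity of evaluation
  suffices.\<close>

lemma laurent_eval_quadratic:
  fixes \<alpha> \<beta> :: "'a::field" and z :: "unit \<Rightarrow> 'a"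
  assumes "z () \<noteq> 0"
  shows "laurent_eval ((laurent_var () - laurent_const \<alpha>) * (laurent_var () - laurent_const \<beta>)) z =
    (z () - \<alpha>) * (z () - \<beta>)"
proof -
  let ?s = "Poly_Mapping.single :: (unit \<Rightarrow>\<^sub>0 int) \<Rightarrow> 'a \<Rightarrow> (unit, 'a) laurent"
  let ?x = "Poly_Mapping.single () (1::int)"
  have eq: "(laurent_var () - laurent_const \<alpha>) * (laurent_var () - laurent_const \<beta>) =
      ?s (?x + ?x) 1 + ?s ?x (- \<beta>) + ?s ?x (- \<alpha>) + ?s 0 (\<alpha> * \<beta>)"
  proof -
    have "laurent_const c = - ?s 0 (- c)" for c by (simp add: laurent_const_def single_uminus)
    thus ?thesis by (simp add: laurent_var_def algebra_simps mult_single)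
  qed
  show ?thesis unfolding eq laurent_eval_add laurent_eval_single
    using assms by (simp add: UNIV_unit lookup_add power_int_add power2_eq_square algebra_simps)
qed

section \<open>The higher Mahler measure of a quadratic polynomial\<close>

text \<open>The coefficient is kept as a quotient of factorials because i! and j! cancel against
  those in the means of the logarithm powers.\<close>

lemma trinomial_expansion:
  fixes a b c :: "'a::field_char_0"
  shows "(a + b + c) ^ k = (\<Sum>(i, j) | i + j \<le> k.
    fact k / (fact i * fact j * fact (k - i - j)) * a ^ (k - i - j) * b ^ i * c ^ j)"
proof -
  have "(a + b + c) ^ k = (b + (c + a)) ^ k" by (simp add: add_ac)
  also have "\<dots> = (\<Sum>i\<le>k. of_nat (k choose i) * b ^ i * (c + a) ^ (k - i))" by (rule binomial_ring)
  also have "\<dots> = (\<Sum>i\<le>k. \<Sum>j\<le>k - i. of_nat (k choose i) * b ^ i *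
      (of_nat ((k - i) choose j) * c ^ j * a ^ (k - i - j)))"
    by (simp add: binomial_ring sum_distrib_left)
  also have "\<dots> = (\<Sum>i\<le>k. \<Sum>j\<le>k - i.
      fact k / (fact i * fact j * fact (k - i - j)) * a ^ (k - i - j) * b ^ i * c ^ j)"
    by (intro sum.cong refl) (simp add: binomial_fact field_simps)
  also have "\<dots> = (\<Sum>(i, j)\<in>Sigma {..k} (\<lambda>i. {..k - i}).
      fact k / (fact i * fact j * fact (k - i - j)) * a ^ (k - i - j) * b ^ i * c ^ j)"
    by (rule sum.Sigma) auto
  also have "Sigma {..k} (\<lambda>i. {..k - i}) = {(i, j). i + j \<le> k}" by auto
  finally show ?thesis .
qed

context Cp_field
begin

text \<open>The dominant terms -\<alpha> and \<zeta> are taken out of the two linear factors; what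
  remains lies in \<open>U0\<close>, and \<zeta> does not affect the logarithm.\<close>

lemma log_p_quadratic:
  assumes "\<alpha> \<noteq> 0" "absval (\<zeta> / \<alpha>) < 1" "absval (\<beta> / \<zeta>) < 1" "\<zeta> \<in> mu_ur p"
  shows "log_p p pw ((\<zeta> - \<alpha>) * (\<zeta> - \<beta>)) =
    log_p p pw \<alpha> + plog (1 - \<zeta> / \<alpha>) + plog (1 - \<beta> / \<zeta>)"
proof -
  have "\<zeta> \<noteq> 0" using mu_ur_absval[OF assms(4)] by auto
  hence "(\<zeta> - \<alpha>) * (\<zeta> - \<beta>) = (- \<alpha>) * \<zeta> * ((1 - \<zeta> / \<alpha>) * (1 - \<beta> / \<zeta>))"
    using assms(1) by (simp add: field_simps)
  moreover have U0: "1 - \<zeta> / \<alpha> \<in> U0" "1 - \<beta> / \<zeta> \<in> U0" using assms by (simp_all add: U0_def)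
  ultimately show ?thesis
    using log_p_mult[OF _ assms(4) U0_mult[OF U0], of "- \<alpha>"] assms(1)
    by (simp only: log_p_minus plog_mult[OF U0] neg_equal_0_iff_equal not_False_eq_True add.assoc)
qed

text \<open>If i = 0 or j = 0, one of the two series is the constant 1, so only the constant terms
  multiply; a positive power of the logarithm has constant term 0.\<close>

definition log_powers_const_term :: "nat \<Rightarrow> nat \<Rightarrow> 'a \<Rightarrow> 'a" where
  "log_powers_const_term i j t = (if i = 0 \<or> j = 0 then (if i = j then 1 else 0)
     else Li_append2 (word (replicate (i - 1) 1) \<^bold>* word (replicate (j - 1) 1)) t)"

lemma log_powers_const_term_sums:
  assumes "absval t < 1"
  shows "(\<lambda>n. log_power_coeff i n * log_power_coeff j n * t ^ n) sums log_powers_const_term i j t"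
proof (cases "i = 0 \<or> j = 0")
  case True
  have "log_power_coeff i 0 * log_power_coeff j 0 * t ^ 0 = log_powers_const_term i j t"
    using True by (cases i; cases j) (auto simp: log_powers_const_term_def log_power_coeff_Suc)
  moreover have "(\<lambda>n. log_power_coeff i n * log_power_coeff j n * t ^ n) sums
      (\<Sum>n\<in>{0}. log_power_coeff i n * log_power_coeff j n * t ^ n)"
    using True by (intro sums_finite) auto
  ultimately show ?thesis by simp
next
  case False
  then obtain i' j' where "i = Suc i'" "j = Suc j'" by (metis not0_implies_Suc)
  thus ?thesis using Li_append2_harmonic_sums[OF assms, of i' j'] by (simp add: log_powers_const_term_def)
qed

text \<open>The two coefficient sequences contain 1/\<alpha>^n and \<beta>^n, whose product is the
  n-th power of \<beta>/\<alpha>; the factorials come from \<open>plog_power_sums\<close>.\<close>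

lemma mean_plog_powers_tendsto:
  fixes \<alpha> \<beta> :: 'a
  assumes \<beta>: "absval \<beta> < 1" and \<alpha>: "1 < absval \<alpha>"
  shows "((\<lambda>N. (\<Sum>\<zeta>\<in>mu N. plog (1 - \<zeta> / \<alpha>) ^ i * plog (1 - \<beta> / \<zeta>) ^ j) / of_nat N) \<longlongrightarrow>
      (-1) ^ (i + j) * fact i * fact j * log_powers_const_term i j (\<beta> / \<alpha>))
      (inf sequentially (principal {N. coprime N p}))"
proof -
  have \<alpha>0: "\<alpha> \<noteq> 0" using \<alpha> by auto
  have inv: "absval (1 / \<alpha>) < 1" using \<alpha> \<alpha>0 by (simp add: absval_divide field_simps)
  have t: "absval (\<beta> / \<alpha>) < 1"
    using mult_strict_mono'[OF \<beta> inv] by (simp add: absval_divide)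
  let ?a = "\<lambda>n. fact i * log_power_coeff i n * (1 / \<alpha>) ^ n :: 'a"
  let ?b = "\<lambda>n. fact j * log_power_coeff j n * \<beta> ^ n :: 'a"
  have lim: "(\<lambda>n. fact i * log_power_coeff i n * x ^ n) \<longlonglongrightarrow> 0" if "absval x < 1" for i and x :: 'a
    using tendsto_mult[OF tendsto_const[of "fact i"] log_power_coeff_tendsto_0[OF that, of i]]
    by (simp add: mult.assoc)
  have "((\<lambda>N. (\<Sum>\<zeta>\<in>mu N. (- plog (1 - \<zeta> / \<alpha>)) ^ i * (- plog (1 - \<beta> / \<zeta>)) ^ j) / of_nat N) \<longlongrightarrow>
      fact i * fact j * log_powers_const_term i j (\<beta> / \<alpha>)) (inf sequentially (principal {N. coprime N p}))"
  proof (rule mean_mu_product_tendsto[of ?a ?b])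
    show "?a \<longlonglongrightarrow> 0" "?b \<longlonglongrightarrow> 0" using lim inv \<beta> by blast+
    show "(\<lambda>n. ?a n * \<zeta> ^ n) sums (- plog (1 - \<zeta> / \<alpha>)) ^ i" if "absval \<zeta> = 1" for \<zeta>
    proof -
      have "absval (\<zeta> / \<alpha>) < 1" using that inv by (simp add: absval_divide)
      from plog_power_sums[OF this, of i] show ?thesis by (simp add: power_divide)
    qed
    show "(\<lambda>n. ?b n * inverse \<zeta> ^ n) sums (- plog (1 - \<beta> / \<zeta>)) ^ j" if "absval \<zeta> = 1" for \<zeta>
    proof -
      have "absval (\<beta> / \<zeta>) < 1" using that \<beta> by (simp add: absval_divide)
      from plog_power_sums[OF this, of j] show ?thesis
        by (simp only: divide_inverse power_mult_distrib mult.assoc)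
    qed
    have "(\<lambda>n. fact i * fact j * (log_power_coeff i n * log_power_coeff j n * (\<beta> / \<alpha>) ^ n)) sums
        (fact i * fact j * log_powers_const_term i j (\<beta> / \<alpha>))"
      by (intro sums_mult_const log_powers_const_term_sums t)
    thus "(\<lambda>n. ?a n * ?b n) sums (fact i * fact j * log_powers_const_term i j (\<beta> / \<alpha>))"
      by (simp add: power_divide mult_ac)
  qed
  \<comment> \<open>The expansions are those of powers of \<open>- plog\<close>; the sign turns them
    into powers of \<open>plog\<close>.\<close>
  from tendsto_mult[OF tendsto_const[of "(-1) ^ (i + j)"] this]
  have "((\<lambda>N. (-1) ^ (i + j) *
        ((\<Sum>\<zeta>\<in>mu N. (- plog (1 - \<zeta> / \<alpha>)) ^ i * (- plog (1 - \<beta> / \<zeta>)) ^ j) / of_nat N)) \<longlongrightarrow>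
      (-1) ^ (i + j) * fact i * fact j * log_powers_const_term i j (\<beta> / \<alpha>))
      (inf sequentially (principal {N. coprime N p}))" by (simp only: mult.assoc)
  moreover have "(-1) ^ (i + j) * ((- x) ^ i * (- y) ^ j) = x ^ i * y ^ j" for x y :: 'a
    using power_mult_distrib[of "-1" "- x" i] power_mult_distrib[of "-1" "- y" j]
    by (simp add: power_add mult_ac)
  ultimately show ?thesis
    by (simp only: times_divide_eq_right sum_distrib_left)
qed

end

theorem theorem1p5:
  fixes p :: nat and pw :: "rat \<Rightarrow> 'a::nonarch_complete_field" and \<alpha> \<beta> :: 'a and k :: nat
  assumes "prime p"
    and "is_Cp p TYPE('a)"
    and "is_p_power p pw"
    and "0 < absval \<beta>" and "absval \<beta> < 1" and "1 < absval \<alpha>"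
    and "1 \<le> k"
  shows "mahler_measure_p p pw k
           ((laurent_var () - laurent_const \<alpha>) * (laurent_var () - laurent_const \<beta>)) =
         log_p p pw \<alpha> ^ k +
         (\<Sum>(i, j) | 1 \<le> i \<and> 1 \<le> j \<and> i + j \<le> k.
            (-1) ^ (i + j) * (fact k / fact (k - i - j)) * log_p p pw \<alpha> ^ (k - i - j) *
            Li_append2 (word (replicate (i - 1) 1) \<^bold>* word (replicate (j - 1) 1)) (\<beta> / \<alpha>))"
proof -
  interpret Cp_field p "TYPE('a)" pw
    using assms(1-3) by unfold_locales (auto simp: is_Cp_def)
  let ?f = "(laurent_var () - laurent_const \<alpha>) * (laurent_var () - laurent_const \<beta>) :: (unit, 'a) laurent"
  let ?F = "inf sequentially (principal {N. coprime N p})"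
  let ?L = "log_p p pw \<alpha>"
  let ?t = "\<beta> / \<alpha>"
  let ?I = "{(i, j). i + j \<le> k}"
  define c where "c = (\<lambda>i j. fact k / (fact i * fact j * fact (k - i - j)) * ?L ^ (k - i - j))"
  \<comment> \<open>The limit of the term at (i, j), after i! and j! in \<open>c\<close> have
    cancelled against the factorials of the mean.\<close>
  define T where "T = (\<lambda>i j. (-1) ^ (i + j) * (fact k / fact (k - i - j)) * ?L ^ (k - i - j) *
      log_powers_const_term i j ?t)"
  have fin: "finite ?I"
    by (rule finite_subset[of _ "{..k} \<times> {..k}"]) auto
  have \<alpha>0: "\<alpha> \<noteq> 0" using assms(6) by auto
  have mean: "(\<Sum>\<zeta> | \<forall>i. \<zeta> i \<in> mu N. log_p p pw (laurent_eval ?f \<zeta>) ^ k) / of_nat N ^ CARD(unit) =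
      (\<Sum>(i, j)\<in>?I. c i j * ((\<Sum>\<zeta>\<in>mu N. plog (1 - \<zeta> / \<alpha>) ^ i * plog (1 - \<beta> / \<zeta>) ^ j) / of_nat N))"
    if N: "N > 0" "coprime N p" for N
  proof -
    \<comment> \<open>A point of the one-dimensional torus is a function on a one-element type and
      is identified with its value.\<close>
    have "(\<Sum>\<zeta> | \<forall>i. \<zeta> i \<in> mu N. log_p p pw (laurent_eval ?f \<zeta>) ^ k) =
        (\<Sum>\<zeta>\<in>mu N. log_p p pw ((\<zeta> - \<alpha>) * (\<zeta> - \<beta>)) ^ k)"
    proof (rule sum.reindex_bij_witness[of _ "\<lambda>\<zeta> _. \<zeta>" "\<lambda>\<zeta>. \<zeta> ()"])
      fix \<zeta> :: "unit \<Rightarrow> 'a" assume "\<zeta> \<in> {\<zeta>. \<forall>i. \<zeta> i \<in> mu N}"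
      hence "\<zeta> () \<noteq> 0" using N(1) by (auto simp: mu_def power_0_left)
      from laurent_eval_quadratic[of \<zeta>, OF this] show "log_p p pw ((\<zeta> () - \<alpha>) * (\<zeta> () - \<beta>)) ^ k = log_p p pw (laurent_eval ?f \<zeta>) ^ k"
        by (simp only:)
    qed auto
    also have "\<dots> = (\<Sum>\<zeta>\<in>mu N. \<Sum>(i, j)\<in>?I. c i j * (plog (1 - \<zeta> / \<alpha>) ^ i * plog (1 - \<beta> / \<zeta>) ^ j))"
    proof (rule sum.cong[OF refl])
      fix \<zeta> :: 'a assume "\<zeta> \<in> mu N"
      hence ur: "\<zeta> \<in> mu_ur p" using N by (auto simp: mu_def mu_ur_def)
      hence "absval \<zeta> = 1" by (rule mu_ur_absval)
      hence "absval (\<zeta> / \<alpha>) < 1" "absval (\<beta> / \<zeta>) < 1"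
        using assms(5,6) \<alpha>0 by (simp_all add: absval_divide field_simps)
      from log_p_quadratic[OF \<alpha>0 this ur]
      show "log_p p pw ((\<zeta> - \<alpha>) * (\<zeta> - \<beta>)) ^ k =
          (\<Sum>(i, j)\<in>?I. c i j * (plog (1 - \<zeta> / \<alpha>) ^ i * plog (1 - \<beta> / \<zeta>) ^ j))"
        by (simp only: trinomial_expansion c_def mult.assoc)
    qed
    also have "\<dots> = (\<Sum>(i, j)\<in>?I. c i j * (\<Sum>\<zeta>\<in>mu N. plog (1 - \<zeta> / \<alpha>) ^ i * plog (1 - \<beta> / \<zeta>) ^ j))"
      by (subst sum.swap) (simp add: case_prod_unfold sum_distrib_left)
    finally have expansion: "(\<Sum>\<zeta> | \<forall>i. \<zeta> i \<in> mu N. log_p p pw (laurent_eval ?f \<zeta>) ^ k) = \<dots>" .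
    show ?thesis
      unfolding expansion UNIV_unit sum_divide_distrib[of _ ?I]
    proof (rule sum.cong[OF refl])
      fix x :: "nat \<times> nat"
      obtain i j where "x = (i, j)" by fastforce
      thus "(case x of (i, j) \<Rightarrow> c i j * (\<Sum>\<zeta>\<in>mu N. plog (1 - \<zeta> / \<alpha>) ^ i * plog (1 - \<beta> / \<zeta>) ^ j)) /
            of_nat N ^ card {()} =
          (case x of (i, j) \<Rightarrow> c i j * ((\<Sum>\<zeta>\<in>mu N. plog (1 - \<zeta> / \<alpha>) ^ i * plog (1 - \<beta> / \<zeta>) ^ j) / of_nat N))"
        by (simp add: sum_divide_distrib[symmetric])
    qed
  qed
  have "((\<lambda>N. \<Sum>(i, j)\<in>?I. c i j *
        ((\<Sum>\<zeta>\<in>mu N. plog (1 - \<zeta> / \<alpha>) ^ i * plog (1 - \<beta> / \<zeta>) ^ j) / of_nat N)) \<longlongrightarrow>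
      (\<Sum>(i, j)\<in>?I. c i j * ((-1) ^ (i + j) * fact i * fact j * log_powers_const_term i j ?t))) ?F"
    unfolding case_prod_unfold
    by (intro tendsto_sum tendsto_mult tendsto_const mean_plog_powers_tendsto assms)
  also have "(\<Sum>(i, j)\<in>?I. c i j * ((-1) ^ (i + j) * fact i * fact j * log_powers_const_term i j ?t)) =
      (\<Sum>(i, j)\<in>?I. T i j)"
    by (intro sum.cong refl) (auto simp: c_def T_def field_simps)
  finally have lim: "((\<lambda>N. \<Sum>(i, j)\<in>?I. c i j *
        ((\<Sum>\<zeta>\<in>mu N. plog (1 - \<zeta> / \<alpha>) ^ i * plog (1 - \<beta> / \<zeta>) ^ j) / of_nat N)) \<longlongrightarrow>
      (\<Sum>(i, j)\<in>?I. T i j)) ?F" .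
  have "eventually (\<lambda>N. (\<Sum>(i, j)\<in>?I. c i j *
        ((\<Sum>\<zeta>\<in>mu N. plog (1 - \<zeta> / \<alpha>) ^ i * plog (1 - \<beta> / \<zeta>) ^ j) / of_nat N)) =
      (\<Sum>\<zeta> | \<forall>i. \<zeta> i \<in> mu N. log_p p pw (laurent_eval ?f \<zeta>) ^ k) / of_nat N ^ CARD(unit)) ?F"
    unfolding eventually_inf_principal using eventually_gt_at_top[of 0]
    by eventually_elim (use mean in auto)
  from Lim_transform_eventually[OF lim this]
  have "mahler_measure_p p pw k ?f = (\<Sum>(i, j)\<in>?I. T i j)"
    unfolding mahler_measure_p_def by (rule tendsto_Lim[OF coprime_filter_nontrivial])
  also have "\<dots> = T 0 0 + (\<Sum>(i, j)\<in>?I - {(0, 0)}. T i j)"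
    using fin by (subst sum.remove[of _ "(0, 0)"]) auto
  \<comment> \<open>Pairs with exactly one zero entry contribute 0 because the constant term of the
    product vanishes there; (0, 0) gives the isolated k-th power.\<close>
  also have "(\<Sum>(i, j)\<in>?I - {(0, 0)}. T i j) = (\<Sum>(i, j) | 1 \<le> i \<and> 1 \<le> j \<and> i + j \<le> k. T i j)"
    using fin by (intro sum.mono_neutral_right) (auto simp: T_def log_powers_const_term_def split: if_splits)
  also have "\<dots> = (\<Sum>(i, j) | 1 \<le> i \<and> 1 \<le> j \<and> i + j \<le> k.
      (-1) ^ (i + j) * (fact k / fact (k - i - j)) * ?L ^ (k - i - j) *
      Li_append2 (word (replicate (i - 1) 1) \<^bold>* word (replicate (j - 1) 1)) ?t)"
    by (rule sum.cong[OF refl]) (auto simp: T_def log_powers_const_term_def)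
  also have "T 0 0 = ?L ^ k" by (simp add: T_def log_powers_const_term_def)
  finally show ?thesis .
qed

end
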